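(* Fix an integer $k\ge3$ and a constant $0<c<c_k$. There exists a constant $t^{\dagger}=t^{\dagger}(c)$ such that, in the $k$-peeling process $(G_t)_{t\ge0}$ on $G\sim\mathcal{G}(n,c/n)$, with high probability every connected component of $G_{t^{\dagger}}$ has $o(\log^3 n)$ vertices.
   Context: $\mathcal{G}(n,p)$ is the binomial random graph on $n$ vertices with independent edge probability $p$; "with high probability" means with probability tending to $1$ as $n\to\infty$. The $k$-peeling process on a graph $G$: $G_0=G$, and for $t\ge0$ the graph $G_{t+1}$ is obtained from $G_t$ by deleting all edges incident with vertices of degree at most $k-1$ in $G_t$ (vertices are never deleted, so every $G_t$ has the same $n$ vertices, some possibly isolated). For $c>0$ let $\beta(c)$ be the largest $x\in[0,1]$ with $x=\Pr[\mathrm{Poisson}(cx)\ge k-1]$, and $c_k=\inf\{c>0:\beta(c)>0\}$ (the threshold for a nonempty $k$-core in $\mathcal{G}(n,c/n)$). *)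

theory Defs
  imports "HOL-Probability.Probability" "HOL-Library.Landau_Symbols"
begin

text \<open>
  A simple graph on a vertex set \<open>V\<close> is given by its set of edges, each edge being a two-element
  subset of \<open>V\<close>.
\<close>

definition all_edges :: "'a set \<Rightarrow> 'a set set" where
  "all_edges V = {e. e \<subseteq> V \<and> card e = 2}"

definition gnp :: "nat \<Rightarrow> real \<Rightarrow> nat set set pmf" where
  "gnp n p = map_pmf (\<lambda>b. {e \<in> all_edges {..<n}. b e})
     (Pi_pmf (all_edges {..<n}) False (\<lambda>_. bernoulli_pmf p))"

definition vertex_degree :: "'a set set \<Rightarrow> 'a \<Rightarrow> nat" where
  "vertex_degree E v = card {e \<in> E. v \<in> e}"

definition peel_step :: "nat \<Rightarrow> 'a set set \<Rightarrow> 'a set set" where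
  "peel_step k E = E - {e \<in> E. \<exists>v\<in>e. vertex_degree E v \<le> k - 1}"

primrec peel :: "nat \<Rightarrow> 'a set set \<Rightarrow> nat \<Rightarrow> 'a set set" where
  "peel k E 0 = E"
| "peel k E (Suc t) = peel_step k (peel k E t)"

text \<open>
  The vertex sets of the connected components, as equivalence classes of reachability. Isolated
  vertices form singleton components.
\<close>

definition graph_components :: "'a set \<Rightarrow> 'a set set \<Rightarrow> 'a set set" where
  "graph_components V E = V // ({(u, v). {u, v} \<in> E}\<^sup>*)"

text \<open>
  The library's \<^const>\<open>poisson_pmf\<close> is only specified for positive rates; the Poisson distribution
  with rate \<open>0\<close> is the point mass at \<open>0\<close>.
\<close>

definition poisson0_pmf :: "real \<Rightarrow> nat pmf" where
  "poisson0_pmf r = (if r > 0 then poisson_pmf r else return_pmf 0)"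

definition core_beta :: "nat \<Rightarrow> real \<Rightarrow> real" where
  "core_beta k c = (GREATEST x. x \<in> {0..1} \<and>
     x = measure_pmf.prob (poisson0_pmf (c * x)) {j. j \<ge> k - 1})"

definition core_threshold :: "nat \<Rightarrow> real" where
  "core_threshold k = Inf {c. c > 0 \<and> core_beta k c > 0}"

end

theory Submission
  imports Defs "HOL-Real_Asymp.Real_Asymp"
begin

text \<open>
  Let \<open>s \<approx> log n\<close>. A component of \<open>G\<^sub>t\<^sub>+\<^sub>1\<close> with at least \<open>s\<close> vertices contains a tree \<open>F\<close> on a set
  \<open>T\<close> of exactly \<open>s\<close> vertices. At least a third of the vertices of \<open>T\<close> have degree at most \<open>2 < k\<close>
  in \<open>F\<close>, so each of them has a further neighbour that survives \<open>t\<close> rounds of peeling. These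
  survivals depend only on a connected set \<open>X \<supseteq> T\<close> of \<open>O(log n)\<close> vertices, and with high probability
  the graph induced on such a set has at most a constant number \<open>m\<close> of independent cycles. Extend
  \<open>F\<close> to a spanning tree of \<open>X\<close>, so that a tree hangs at every vertex of \<open>T\<close>. Each of the at most
  \<open>m\<close> edges outside the spanning tree touches at most two of the hanging trees; if a hanging tree is
  not touched, then the survival of its root is witnessed by a \<open>(k - 1)\<close>-ary tree inside it. So all
  but \<open>2m\<close> of the low-degree vertices have pairwise disjoint witnesses.

  By the van den Berg--Kesten inequality a given tree occurs with disjoint witnesses at \<open>j\<close> given
  vertices with probability at most \<open>(c/n)\<^bsup>s-1\<^esup> (c \<lambda>\<^sub>t)\<^bsup>j\<^esup>\<close>, where \<open>\<lambda>\<^sub>t\<close> bounds the probability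
  that a vertex is the root of a tree witness. A more general form of the inequality gives
  \<open>\<lambda>\<^sub>t\<^sub>+\<^sub>1 \<le> Pr[Bin(n, c \<lambda>\<^sub>t / n) \<ge> k - 1]\<close>, so \<open>\<lambda>\<^sub>t\<close> is governed by the iteration of
  \<open>x \<mapsto> Pr[Poisson(cx) \<ge> k - 1]\<close> from \<open>1\<close>, which tends to \<open>0\<close> because \<open>c < c\<^sub>k\<close>. As there are
  at most \<open>(e n)\<^bsup>s\<^esup>\<close> trees on \<open>s\<close> of the \<open>n\<close> vertices, a first moment bound finishes the proof once
  \<open>c \<lambda>\<^sub>t\<close> is small enough.
\<close>

section \<open>Random subsets and disjoint occurrence\<close>

abbreviation prob :: "'a pmf \<Rightarrow> 'a set \<Rightarrow> real" where
  "prob M \<equiv> measure_pmf.prob M"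

lemma prob_bind_pmf_mono:
  assumes "\<And>x. x \<in> set_pmf M \<Longrightarrow> prob (N x) A \<le> prob (N' x) B"
  shows "prob (bind_pmf M N) A \<le> prob (bind_pmf M N') B"
proof -
  have "emeasure (bind_pmf M N) A \<le> emeasure (bind_pmf M N') B"
    unfolding emeasure_bind_pmf
    by (intro nn_integral_mono_AE)
       (auto simp: AE_measure_pmf_iff measure_pmf.emeasure_eq_measure intro!: ennreal_leI assms)
  then show ?thesis
    by (simp add: measure_pmf.emeasure_eq_measure)
qed

lemma prob_bind_bernoulli:
  assumes "0 \<le> q" "q \<le> 1"
  shows "prob (bind_pmf (bernoulli_pmf q) N) A = q * prob (N True) A + (1 - q) * prob (N False) A"
proof -
  have "emeasure (bind_pmf (bernoulli_pmf q) N) A =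
      ennreal (q * prob (N True) A + (1 - q) * prob (N False) A)"
    unfolding emeasure_bind_pmf using assms
    by (simp add: measure_pmf.emeasure_eq_measure ennreal_plus ennreal_mult mult.commute)
  then show ?thesis
    using assms by (simp add: measure_pmf.emeasure_eq_measure del: ennreal_plus)
qed

lemma bind_bernoulli_pmf_bernoulli:
  assumes "q \<in> {0..1}" "\<And>x. r x \<in> {0..1}"
  shows "bind_pmf (bernoulli_pmf q) (\<lambda>x. bernoulli_pmf (r x)) =
    bernoulli_pmf (q * r True + (1 - q) * r False)"
proof (rule pmf_eqI)
  fix y
  have "r True \<in> {0..1}" "r False \<in> {0..1}"
    using assms by blast+
  moreover from this have "q * r True + (1 - q) * r False \<in> {0..1}"
    using convex_bound_le[of "r True" 1 "r False" q "1 - q"] assms(1) by auto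
  ultimately show "pmf (bind_pmf (bernoulli_pmf q) (\<lambda>x. bernoulli_pmf (r x))) y =
      pmf (bernoulli_pmf (q * r True + (1 - q) * r False)) y"
    using assms(1) by (cases y) (simp_all add: pmf_bind algebra_simps)
qed

lemma bernoulli_pmf_of_bool: "bernoulli_pmf (of_bool P) = return_pmf P"
  by (intro pmf_eqI) (auto simp: bernoulli_pmf.rep_eq split: bool.splits)

definition random_subset :: "'a set \<Rightarrow> ('a \<Rightarrow> real) \<Rightarrow> 'a set pmf" where
  "random_subset A p = map_pmf (\<lambda>b. {e \<in> A. b e}) (Pi_pmf A False (\<lambda>e. bernoulli_pmf (p e)))"

lemma random_subset_empty [simp]: "random_subset {} p = return_pmf {}"
  by (simp add: random_subset_def)

lemma random_subset_insert:
  assumes "finite A" "e \<notin> A"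
  shows "random_subset (insert e A) p =
    bind_pmf (bernoulli_pmf (p e)) (\<lambda>x. map_pmf (if x then insert e else id) (random_subset A p))"
proof -
  have "{e' \<in> insert e A. (b(e := y)) e'} = (if y then insert e else id) {e' \<in> A. b e'}"
    for b and y :: bool
    using assms(2) by auto
  then show ?thesis
    unfolding random_subset_def Pi_pmf_insert'[OF assms] map_pmf_def
    by (simp only: bind_assoc_pmf bind_return_pmf)
qed

lemma prob_random_subset_insert:
  assumes "finite A" "e \<notin> A" "0 \<le> p e" "p e \<le> 1"
  shows "prob (random_subset (insert e A) p) \<S> =
    p e * prob (random_subset A p) {E. insert e E \<in> \<S>} + (1 - p e) * prob (random_subset A p) \<S>"
  unfolding random_subset_insert[OF assms(1,2)] prob_bind_bernoulli[OF assms(3,4)]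
  by (simp add: vimage_def)

lemma set_pmf_random_subset: "E \<in> set_pmf (random_subset A p) \<Longrightarrow> E \<subseteq> A"
  by (auto simp: random_subset_def)

lemma random_subset_of_bool:
  "finite A \<Longrightarrow> random_subset A (\<lambda>e. of_bool (P e)) = return_pmf {e \<in> A. P e}"
  by (simp add: random_subset_def bernoulli_pmf_of_bool cong: conj_cong)

lemma bind_random_subset_random_subset:
  assumes "finite A" "\<And>e. q e \<in> {0..1}" "\<And>x e. r x e \<in> {0..1}"
  shows "bind_pmf (random_subset A q) (\<lambda>E. random_subset A (\<lambda>e. r (e \<in> E) e)) =
    random_subset A (\<lambda>e. q e * r True e + (1 - q e) * r False e)"
proof -
  have "random_subset A (\<lambda>e. r (e \<in> {e \<in> A. b e}) e) = random_subset A (\<lambda>e. r (b e) e)" for b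
    unfolding random_subset_def by (intro arg_cong[where f = "map_pmf _"] Pi_pmf_cong) auto
  then have "bind_pmf (random_subset A q) (\<lambda>E. random_subset A (\<lambda>e. r (e \<in> E) e)) =
      map_pmf (\<lambda>b. {e \<in> A. b e}) (bind_pmf (Pi_pmf A False (\<lambda>e. bernoulli_pmf (q e)))
        (\<lambda>b. Pi_pmf A False (\<lambda>e. bernoulli_pmf (r (b e) e))))"
    unfolding random_subset_def[of A q] bind_map_pmf
    by (simp add: random_subset_def map_bind_pmf)
  also have "\<dots> = map_pmf (\<lambda>b. {e \<in> A. b e})
      (Pi_pmf A False (\<lambda>e. bind_pmf (bernoulli_pmf (q e)) (\<lambda>x. bernoulli_pmf (r x e))))"
    by (simp add: Pi_pmf_bind[OF assms(1), where d' = False])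
  also have "\<dots> = random_subset A (\<lambda>e. q e * r True e + (1 - q e) * r False e)"
    unfolding random_subset_def using assms(2,3) by (simp add: bind_bernoulli_pmf_bernoulli)
  finally show ?thesis .
qed

lemma prob_random_subset_superset_le:
  assumes "finite A" "\<And>e. 0 \<le> p e" "\<And>e. p e \<le> 1"
  shows "prob (random_subset A p) {E. F \<subseteq> E} \<le> (\<Prod>e\<in>F. p e)"
proof (cases "F \<subseteq> A")
  case True
  have "(\<lambda>b. {e \<in> A. b e}) -` {E. F \<subseteq> E} = Pi A (\<lambda>e. if e \<in> F then {True} else UNIV)"
    using True by (auto simp: Pi_def)
  then have "prob (random_subset A p) {E. F \<subseteq> E} =
      (\<Prod>e\<in>A. prob (bernoulli_pmf (p e)) (if e \<in> F then {True} else UNIV))"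
    unfolding random_subset_def using assms(1) by (simp add: measure_Pi_pmf_Pi)
  also have "\<dots> = (\<Prod>e\<in>A. if e \<in> F then p e else 1)"
    using assms by (intro prod.cong) (auto simp: measure_pmf_single)
  also have "\<dots> = (\<Prod>e\<in>F. p e)"
    using True assms(1) by (simp add: prod.If_cases Int_absorb1 flip: Int_def)
  finally show ?thesis by simp
next
  case False
  then have "prob (random_subset A p) {E. F \<subseteq> E} = 0"
    by (subst measure_pmf_zero_iff) (auto dest: set_pmf_random_subset)
  then show ?thesis
    using assms(2) by (simp add: prod_nonneg)
qed

lemma prob_random_subset_member:
  assumes "finite A" "e \<in> A" "0 \<le> p e" "p e \<le> 1"
  shows "prob (random_subset A p) {E. e \<in> E} = p e"
proof -
  have "prob (random_subset A p) {E. e \<in> E} =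
      prob (map_pmf (\<lambda>b. b e) (Pi_pmf A False (\<lambda>e. bernoulli_pmf (p e)))) {True}"
    using assms(2) by (simp add: random_subset_def vimage_def)
  also have "\<dots> = p e"
    using assms by (simp add: Pi_pmf_component measure_pmf_single)
  finally show ?thesis .
qed

lemma prob_random_subset_mono:
  assumes "finite A" "\<And>e. 0 \<le> p e" "\<And>e. p e \<le> q e" "\<And>e. q e \<le> 1"
    and "\<And>E F. E \<in> \<S> \<Longrightarrow> E \<subseteq> F \<Longrightarrow> F \<subseteq> A \<Longrightarrow> F \<in> \<S>"
  shows "prob (random_subset A p) \<S> \<le> prob (random_subset A q) \<S>"
  using assms(1,5)
proof (induction A arbitrary: \<S> rule: finite_induct)
  case (insert e A)
  define \<S>' where "\<S>' = {E. insert e E \<in> \<S>}"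
  let ?P = "prob (random_subset A p)" and ?Q = "prob (random_subset A q)"
  have le_\<S>: "?P \<S> \<le> ?Q \<S>" and le_\<S>': "?P \<S>' \<le> ?Q \<S>'"
    using insert.prems unfolding \<S>'_def by (intro insert.IH; blast)+
  have "?Q \<S> \<le> ?Q \<S>'"
  proof -
    have "?Q (\<S> \<inter> set_pmf (random_subset A q)) \<le> ?Q \<S>'"
    proof (intro measure_pmf.finite_measure_mono subsetI)
      fix E assume "E \<in> \<S> \<inter> set_pmf (random_subset A q)"
      then show "E \<in> \<S>'"
        using insert.prems[of E "insert e E"] set_pmf_random_subset[of E A q] by (auto simp: \<S>'_def)
    qed simp
    then show ?thesis by (simp add: measure_Int_set_pmf)
  qed
  have p01: "0 \<le> p e" "p e \<le> 1" and q01: "0 \<le> q e" "q e \<le> 1"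
    using assms by (meson order_trans)+
  have "prob (random_subset (insert e A) p) \<S> = p e * ?P \<S>' + (1 - p e) * ?P \<S>"
    unfolding \<S>'_def by (intro prob_random_subset_insert insert.hyps p01)
  also have "\<dots> \<le> p e * ?Q \<S>' + (1 - p e) * ?Q \<S>"
    using le_\<S> le_\<S>' p01 by (intro add_mono mult_left_mono) auto
  also have "\<dots> = ?Q \<S> + p e * (?Q \<S>' - ?Q \<S>)"
    by (simp add: algebra_simps)
  also have "\<dots> \<le> ?Q \<S> + q e * (?Q \<S>' - ?Q \<S>)"
    using assms(3) \<open>?Q \<S> \<le> ?Q \<S>'\<close> by (intro add_left_mono mult_right_mono) auto
  also have "\<dots> = q e * ?Q \<S>' + (1 - q e) * ?Q \<S>"
    by (simp add: algebra_simps)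
  also have "\<dots> = prob (random_subset (insert e A) q) \<S>"
    unfolding \<S>'_def by (intro prob_random_subset_insert[symmetric] insert.hyps q01)
  finally show ?case .
qed simp

lemma prob_card_random_subset_ge:
  assumes "finite A" "0 \<le> q" "q \<le> 1"
  shows "prob (random_subset A (\<lambda>_. q)) {E. m \<le> card E} = prob (binomial_pmf (card A) q) {m..}"
  using assms
  by (simp add: random_subset_def binomial_pmf_altdef'[OF assms(1) refl, where dflt = False]
      vimage_def)

definition occurs :: "'a set set \<Rightarrow> 'a set \<Rightarrow> bool" where
  "occurs \<W> E \<longleftrightarrow> (\<exists>W\<in>\<W>. W \<subseteq> E)"

definition occur_disjointly :: "'i set set \<Rightarrow> ('i \<Rightarrow> 'a set set) \<Rightarrow> 'a set \<Rightarrow> bool" where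
  "occur_disjointly \<J> \<W> E \<longleftrightarrow>
    (\<exists>J\<in>\<J>. \<exists>W. (\<forall>j\<in>J. W j \<in> \<W> j \<and> W j \<subseteq> E) \<and> disjoint_family_on W J)"

definition occurrence_prob :: "'a set \<Rightarrow> ('a \<Rightarrow> real) \<Rightarrow> 'a set set \<Rightarrow> real" where
  "occurrence_prob A p \<W> = prob (random_subset A p) {E. occurs \<W> E}"

lemma occurrence_prob_nonneg [simp]: "0 \<le> occurrence_prob A p \<W>"
  and occurrence_prob_le_1 [simp]: "occurrence_prob A p \<W> \<le> 1"
  by (simp_all add: occurrence_prob_def)

definition reveal :: "'a \<Rightarrow> bool \<Rightarrow> 'a set set \<Rightarrow> 'a set set" where
  "reveal e present \<W> = (if present then (\<lambda>W. W - {e}) ` \<W> else \<W>)"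

lemma Collect_occurs_reveal:
  "{E. occurs (reveal e present \<W>) E} = {E. occurs \<W> (if present then insert e E else E)}"
  by (auto simp: reveal_def occurs_def)

lemma occurrence_prob_insert:
  assumes "finite A" "e \<notin> A" "0 \<le> p e" "p e \<le> 1"
  shows "occurrence_prob (insert e A) p \<W> =
    p e * occurrence_prob A p (reveal e True \<W>) +
    (1 - p e) * occurrence_prob A p (reveal e False \<W>)"
  unfolding occurrence_prob_def Collect_occurs_reveal
  by (subst prob_random_subset_insert) (use assms in simp_all)

lemma occur_disjointly_revealI:
  assumes "J \<in> \<J>" "\<And>j. j \<in> J \<Longrightarrow> W j \<in> \<W> j \<and> W j \<subseteq> insert e E" "disjoint_family_on W J"
    and "\<And>j. j \<in> J \<Longrightarrow> e \<in> W j \<Longrightarrow> present j"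
  shows "occur_disjointly \<J> (\<lambda>j. reveal e (present j) (\<W> j)) E"
proof -
  have "W j - {e} \<in> reveal e (present j) (\<W> j)" if "j \<in> J" for j
  proof (cases "present j")
    case False
    then have "W j - {e} = W j" using assms(4)[OF that] by blast
    then show ?thesis using False assms(2)[OF that] by (simp add: reveal_def)
  qed (use assms(2)[OF that] in \<open>auto simp: reveal_def\<close>)
  moreover have "W j - {e} \<subseteq> E" if "j \<in> J" for j
    using assms(2)[OF that] by blast
  moreover have "disjoint_family_on (\<lambda>j. W j - {e}) J"
    using assms(3) by (auto simp: disjoint_family_on_def)
  ultimately show ?thesis
    unfolding occur_disjointly_def using assms(1)
    by (intro bexI[of _ J] exI[of _ "\<lambda>j. W j - {e}"]) auto
qed

text \<open>
  Among disjoint witnesses at most one contains \<open>e\<close>, so it is enough that its index has a copy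
  of \<open>e\<close>.
\<close>

lemma occur_disjointly_insertE:
  assumes "occur_disjointly \<J> \<W> (insert e E)" "\<not> occur_disjointly \<J> \<W> E"
  obtains i where "i \<in> \<Union>\<J>"
    "\<And>present. present i \<Longrightarrow> occur_disjointly \<J> (\<lambda>j. reveal e (present j) (\<W> j)) E"
proof -
  obtain J W where W: "J \<in> \<J>" "\<forall>j\<in>J. W j \<in> \<W> j \<and> W j \<subseteq> insert e E" "disjoint_family_on W J"
    using assms(1) by (auto simp: occur_disjointly_def)
  obtain i where i: "i \<in> J" "e \<in> W i"
    using W assms(2) by (fastforce simp: occur_disjointly_def)
  have "j = i" if "j \<in> J" "e \<in> W j" for j
    using W(3) i that by (auto simp: disjoint_family_on_def)
  then have "occur_disjointly \<J> (\<lambda>j. reveal e (present j) (\<W> j)) E" if "present i" for present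
    using W that by (intro occur_disjointly_revealI[of J _ W]) auto
  then show ?thesis using that W(1) i(1) by blast
qed

lemma prob_occur_disjointly_shared_le_copies:
  assumes "finite I" "\<J> \<subseteq> Pow I" "0 \<le> q" "q \<le> 1" "e \<notin> E"
  shows "prob (bernoulli_pmf q) {x. occur_disjointly \<J> \<W> ((if x then insert e else id) E)} \<le>
    prob (random_subset I (\<lambda>_. q)) {C. occur_disjointly \<J> (\<lambda>j. reveal e (j \<in> C) (\<W> j)) E}"
    (is "_ \<le> prob ?copies {C. ?occ C}")
proof -
  consider (without) "occur_disjointly \<J> \<W> E"
    | (needs) "\<not> occur_disjointly \<J> \<W> E" "occur_disjointly \<J> \<W> (insert e E)"
    | (never) "\<not> occur_disjointly \<J> \<W> E" "\<not> occur_disjointly \<J> \<W> (insert e E)"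
    by blast
  then show ?thesis
  proof cases
    case without
    then obtain J W where "J \<in> \<J>" "\<forall>j\<in>J. W j \<in> \<W> j \<and> W j \<subseteq> E" "disjoint_family_on W J"
      by (auto simp: occur_disjointly_def)
    then have "?occ C" for C
      using assms(5) by (intro occur_disjointly_revealI[of J _ W]) auto
    then show ?thesis by simp
  next
    case needs
    obtain i where i: "i \<in> \<Union>\<J>" "\<And>C. i \<in> C \<Longrightarrow> ?occ C"
      using occur_disjointly_insertE[OF needs(2,1)] by metis
    have "{x. occur_disjointly \<J> \<W> ((if x then insert e else id) E)} = {True}"
      using needs by (auto split: if_splits)
    then have "prob (bernoulli_pmf q)
        {x. occur_disjointly \<J> \<W> ((if x then insert e else id) E)} = q"
      using assms(3,4) by (simp add: measure_pmf_single)
    also have "\<dots> = prob ?copies {C. i \<in> C}"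
      using assms i(1) by (intro prob_random_subset_member[symmetric]) auto
    also have "\<dots> \<le> prob ?copies {C. ?occ C}"
      using i(2) by (intro measure_pmf.finite_measure_mono) auto
    finally show ?thesis .
  next
    case never
    then have "{x. occur_disjointly \<J> \<W> ((if x then insert e else id) E)} = {}"
      by (auto split: if_splits)
    then show ?thesis by simp
  qed
qed

lemma prob_occur_disjointly_insert_le_copies:
  assumes "finite A" "e \<notin> A" "finite I" "\<J> \<subseteq> Pow I" "0 \<le> p e" "p e \<le> 1"
  shows "prob (random_subset (insert e A) p) {E. occur_disjointly \<J> \<W> E} \<le>
    prob (bind_pmf (random_subset I (\<lambda>_. p e)) (\<lambda>C. map_pmf
      (occur_disjointly \<J> (\<lambda>j. reveal e (j \<in> C) (\<W> j))) (random_subset A p))) {True}"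
proof -
  let ?copies = "random_subset I (\<lambda>_. p e)"
  let ?occ = "\<lambda>C E. occur_disjointly \<J> (\<lambda>j. reveal e (j \<in> C) (\<W> j)) E"
  have "prob (random_subset (insert e A) p) {E. occur_disjointly \<J> \<W> E} =
      prob (bind_pmf (random_subset A p) (\<lambda>E. map_pmf (\<lambda>x. (if x then insert e else id) E)
        (bernoulli_pmf (p e)))) {E. occur_disjointly \<J> \<W> E}"
    unfolding random_subset_insert[OF assms(1,2)] map_pmf_def
    by (subst bind_commute_pmf) simp
  also have "\<dots> \<le> prob (bind_pmf (random_subset A p) (\<lambda>E. map_pmf (\<lambda>C. ?occ C E) ?copies)) {True}"
  proof (intro prob_bind_pmf_mono)
    fix E assume "E \<in> set_pmf (random_subset A p)"
    then have "e \<notin> E" using set_pmf_random_subset assms(2) by blast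
    from prob_occur_disjointly_shared_le_copies[OF assms(3-6) this, of \<W>]
    show "prob (map_pmf (\<lambda>x. (if x then insert e else id) E) (bernoulli_pmf (p e)))
          {E. occur_disjointly \<J> \<W> E} \<le> prob (map_pmf (\<lambda>C. ?occ C E) ?copies) {True}"
      by (simp add: vimage_def)
  qed
  also have "\<dots> = prob (bind_pmf ?copies (\<lambda>C. map_pmf (?occ C) (random_subset A p))) {True}"
    unfolding map_pmf_def by (subst bind_commute_pmf) simp
  finally show ?thesis .
qed

text \<open>
  The van den Berg--Kesten inequality, in the form that replaces disjoint occurrence by
  independent copies of the underlying randomness, one copy for each index. The elements of \<open>A\<close>
  are replaced by copies one at a time.
\<close>

theorem prob_occur_disjointly_le_independent:
  fixes \<W> :: "'i \<Rightarrow> 'a set set"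
  assumes "finite A" "finite I" "\<And>e. 0 \<le> p e" "\<And>e. p e \<le> 1" "\<J> \<subseteq> Pow I"
    and up: "\<And>J J'. J \<in> \<J> \<Longrightarrow> J \<subseteq> J' \<Longrightarrow> J' \<subseteq> I \<Longrightarrow> J' \<in> \<J>"
  shows "prob (random_subset A p) {E. occur_disjointly \<J> \<W> E} \<le>
    prob (random_subset I (\<lambda>j. occurrence_prob A p (\<W> j))) \<J>"
  using assms(1)
proof (induction A arbitrary: \<W> rule: finite_induct)
  case empty
  have "{j \<in> I. occurs (\<W> j) {}} \<in> \<J>" if "occur_disjointly \<J> \<W> {}"
  proof -
    from that obtain J W where J: "J \<in> \<J>" "\<forall>j\<in>J. W j \<in> \<W> j \<and> W j \<subseteq> {}"
      unfolding occur_disjointly_def by blast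
    then have "J \<subseteq> {j \<in> I. occurs (\<W> j) {}}"
      unfolding occurs_def using assms(5) by blast
    then show ?thesis by (rule up[OF J(1)]) auto
  qed
  moreover have "occurrence_prob {} p (\<W> j) = of_bool (occurs (\<W> j) {})" for j
    by (simp add: occurrence_prob_def indicator_def)
  ultimately show ?case
    using assms(2) by (simp add: random_subset_of_bool indicator_def)
next
  case (insert e A)
  let ?\<W> = "\<lambda>C j. reveal e (j \<in> C) (\<W> j)"
  have "prob (random_subset (insert e A) p) {E. occur_disjointly \<J> \<W> E} \<le>
      prob (bind_pmf (random_subset I (\<lambda>_. p e)) (\<lambda>C. map_pmf
        (occur_disjointly \<J> (?\<W> C)) (random_subset A p))) {True}"
    using assms insert.hyps by (intro prob_occur_disjointly_insert_le_copies)
  also have "\<dots> \<le> prob (bind_pmf (random_subset I (\<lambda>_. p e))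
      (\<lambda>C. random_subset I (\<lambda>j. occurrence_prob A p (?\<W> C j)))) \<J>"
    by (intro prob_bind_pmf_mono) (use insert.IH in \<open>simp add: vimage_def\<close>)
  also have "\<dots> = prob (random_subset I (\<lambda>j. occurrence_prob (insert e A) p (\<W> j))) \<J>"
    using assms(2-4) insert.hyps bind_random_subset_random_subset[of I "\<lambda>_. p e"
        "\<lambda>x j. occurrence_prob A p (reveal e x (\<W> j))"]
    by (simp add: occurrence_prob_insert)
  finally show ?case .
qed

corollary van_den_Berg_Kesten:
  assumes "finite A" "finite J" "\<And>e. 0 \<le> p e" "\<And>e. p e \<le> 1"
  shows "prob (random_subset A p) {E. occur_disjointly {J} \<W> E} \<le> (\<Prod>j\<in>J. occurrence_prob A p (\<W> j))"
proof -
  let ?q = "\<lambda>j. occurrence_prob A p (\<W> j)"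
  have "prob (random_subset A p) {E. occur_disjointly {J} \<W> E} \<le> prob (random_subset J ?q) {J}"
    using assms by (intro prob_occur_disjointly_le_independent) auto
  also have "\<dots> \<le> prob (random_subset J ?q) {E. J \<subseteq> E}"
    by (intro measure_pmf.finite_measure_mono) auto
  also have "\<dots> \<le> (\<Prod>j\<in>J. ?q j)"
    using assms(2) by (intro prob_random_subset_superset_le) auto
  finally show ?thesis .
qed

corollary prob_occur_disjointly_card_le_binomial:
  assumes "finite A" "finite I" "\<And>e. 0 \<le> p e" "\<And>e. p e \<le> 1"
    and "\<And>j. occurrence_prob A p (\<W> j) \<le> q" "q \<le> 1"
  shows "prob (random_subset A p) {E. occur_disjointly {J. J \<subseteq> I \<and> m \<le> card J} \<W> E} \<le>
    prob (binomial_pmf (card I) q) {m..}"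
proof -
  let ?\<J> = "{J. J \<subseteq> I \<and> m \<le> card J}"
  have up: "J' \<in> ?\<J>" if "J \<in> ?\<J>" "J \<subseteq> J'" "J' \<subseteq> I" for J J'
    using that card_mono[of J' J] finite_subset[OF _ assms(2)] by fastforce
  have "prob (random_subset A p) {E. occur_disjointly ?\<J> \<W> E} \<le>
      prob (random_subset I (\<lambda>j. occurrence_prob A p (\<W> j))) ?\<J>"
    using assms up by (intro prob_occur_disjointly_le_independent) auto
  also have "\<dots> \<le> prob (random_subset I (\<lambda>_. q)) ?\<J>"
    using assms up by (intro prob_random_subset_mono) auto
  also have "\<dots> \<le> prob (random_subset I (\<lambda>_. q)) {J. m \<le> card J}"
    by (intro measure_pmf.finite_measure_mono) auto
  also have "\<dots> = prob (binomial_pmf (card I) q) {m..}"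
  proof -
    have "0 \<le> q" using assms(5) occurrence_prob_nonneg by (rule order_trans[rotated])
    then show ?thesis using assms by (intro prob_card_random_subset_ge)
  qed
  finally show ?thesis .
qed

definition pendant :: "'a \<Rightarrow> 'a set set \<Rightarrow> 'a set set" where
  "pendant e \<W> = {insert e W | W. W \<in> \<W> \<and> e \<notin> W}"

lemma prob_superset_and_occur_disjointly_le:
  assumes "finite A" "finite J" "\<And>e. 0 \<le> p e" "\<And>e. p e \<le> 1"
  shows "prob (random_subset A p) {E. F \<subseteq> E \<and> occur_disjointly {J} \<W> (E - F)} \<le>
    (\<Prod>e\<in>F. p e) * (\<Prod>j\<in>J. occurrence_prob A p (\<W> j))"
proof -
  define \<V> where "\<V> = case_option {F} \<W>"
  let ?J = "insert None (Some ` J)"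
  have "occur_disjointly {?J} \<V> E" if "F \<subseteq> E" "occur_disjointly {J} \<W> (E - F)" for E
  proof -
    from that(2) obtain W where W: "\<forall>j\<in>J. W j \<in> \<W> j \<and> W j \<subseteq> E - F" "disjoint_family_on W J"
      by (auto simp: occur_disjointly_def)
    have "disjoint_family_on (case_option F W) ?J"
      using W by (auto simp: disjoint_family_on_def)
    moreover have "\<forall>i\<in>?J. case_option F W i \<in> \<V> i \<and> case_option F W i \<subseteq> E"
      using W(1) that(1) by (auto simp: \<V>_def)
    ultimately show ?thesis
      unfolding occur_disjointly_def by blast
  qed
  then have "prob (random_subset A p) {E. F \<subseteq> E \<and> occur_disjointly {J} \<W> (E - F)} \<le>
      prob (random_subset A p) {E. occur_disjointly {?J} \<V> E}"
    by (intro measure_pmf.finite_measure_mono) auto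
  also have "\<dots> \<le> (\<Prod>i\<in>?J. occurrence_prob A p (\<V> i))"
    using assms by (intro van_den_Berg_Kesten) auto
  also have "\<dots> = occurrence_prob A p {F} * (\<Prod>j\<in>J. occurrence_prob A p (\<W> j))"
    using assms(2) by (subst prod.insert) (auto simp: \<V>_def prod.reindex)
  also have "occurrence_prob A p {F} \<le> (\<Prod>e\<in>F. p e)"
    unfolding occurrence_prob_def occurs_def
    using prob_random_subset_superset_le[OF assms(1,3,4)] by simp
  finally show ?thesis
    by (simp add: mult_right_mono prod_nonneg)
qed

corollary occurrence_prob_pendant_le:
  assumes "finite A" "\<And>e. 0 \<le> p e" "\<And>e. p e \<le> 1" "occurrence_prob A p \<W> \<le> b"
  shows "occurrence_prob A p (pendant e \<W>) \<le> p e * b"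
proof -
  have "{e} \<subseteq> E \<and> occur_disjointly {{()}} (\<lambda>_. \<W>) (E - {e})" if "occurs (pendant e \<W>) E" for E
    using that
    by (fastforce simp: occurs_def pendant_def occur_disjointly_def disjoint_family_on_def)
  then have "occurrence_prob A p (pendant e \<W>) \<le>
      prob (random_subset A p) {E. {e} \<subseteq> E \<and> occur_disjointly {{()}} (\<lambda>_. \<W>) (E - {e})}"
    unfolding occurrence_prob_def by (intro measure_pmf.finite_measure_mono) auto
  also have "\<dots> \<le> p e * occurrence_prob A p \<W>"
    using prob_superset_and_occur_disjointly_le[OF assms(1) _ assms(2,3),
        where J = "{()}" and F = "{e}"]
    by simp
  also have "\<dots> \<le> p e * b"
    using assms(4,2) by (rule mult_left_mono)
  finally show ?thesis .
qed

section \<open>Branchings and spanning trees\<close>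

lemma finite_all_edges [simp]: "finite V \<Longrightarrow> finite (all_edges V)"
  by (auto simp: all_edges_def)

lemma card_all_edges: "finite V \<Longrightarrow> card (all_edges V) = card V choose 2"
  unfolding all_edges_def by (rule n_subsets)

definition induced :: "'a set set \<Rightarrow> 'a set \<Rightarrow> 'a set set" where
  "induced E X = {e \<in> E. e \<subseteq> X}"

definition connected_in :: "'a set set \<Rightarrow> 'a set \<Rightarrow> bool" where
  "connected_in E X \<longleftrightarrow> (\<forall>Y. Y \<noteq> {} \<longrightarrow> Y \<subset> X \<longrightarrow> (\<exists>y\<in>Y. \<exists>z\<in>X - Y. {y, z} \<in> E))"

lemma connected_in_cut:
  assumes "connected_in E X" "Y \<noteq> {}" "Y \<subset> X"
  obtains y z where "y \<in> Y" "z \<in> X - Y" "{y, z} \<in> E"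
  using assms(1)[unfolded connected_in_def, rule_format, OF assms(2,3)] by blast

lemma connected_in_mono: "connected_in E X \<Longrightarrow> E \<subseteq> E' \<Longrightarrow> connected_in E' X"
  unfolding connected_in_def by (meson subsetD)

lemma connected_in_Un_neighbours:
  assumes "connected_in E X" "\<And>u. u \<in> U \<Longrightarrow> \<exists>x\<in>X. {x, u} \<in> E"
  shows "connected_in E (X \<union> U)"
  unfolding connected_in_def
proof (intro allI impI)
  fix Y assume Y: "Y \<noteq> {}" "Y \<subset> X \<union> U"
  consider (within) "Y \<inter> X \<noteq> {}" "Y \<inter> X \<subset> X" | (above) "X \<subseteq> Y" | (outside) "Y \<inter> X = {}"
    by blast
  then show "\<exists>y\<in>Y. \<exists>z\<in>X \<union> U - Y. {y, z} \<in> E"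
  proof cases
    case within
    then show ?thesis by (rule connected_in_cut[OF assms(1)]) blast
  next
    case above
    then show ?thesis using Y assms(2) by blast
  next
    case outside
    then obtain u where u: "u \<in> Y" "u \<in> U" using Y by blast
    then obtain x where "x \<in> X" "{u, x} \<in> E" using assms(2) by (metis insert_commute)
    then show ?thesis using u(1) outside by blast
  qed
qed

lemma connected_in_induced: "connected_in E X \<Longrightarrow> connected_in (induced E X) X"
  unfolding connected_in_def induced_def by blast

definition undirected :: "('a \<times> 'a) set \<Rightarrow> 'a set set" where
  "undirected R = (\<lambda>(y, z). {y, z}) ` R"

lemma undirected_empty [simp]: "undirected {} = {}"
  and undirected_insert [simp]: "undirected (insert (y, z) R) = insert {y, z} (undirected R)"
  and undirected_mono: "R \<subseteq> R' \<Longrightarrow> undirected R \<subseteq> undirected R'"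
  by (auto simp: undirected_def)

lemma undirectedE:
  assumes "{y, z} \<in> undirected R"
  obtains "(y, z) \<in> R" | "(z, y) \<in> R"
  using assms by (auto simp: undirected_def doubleton_eq_iff)

lemma inj_on_undirected:
  assumes "acyclic R"
  shows "inj_on (\<lambda>(y, z). {y, z}) R"
proof -
  have "\<not> ((y, z) \<in> R \<and> (z, y) \<in> R)" for y z
    using assms by (meson acyclic_def trancl.intros)
  then show ?thesis by (auto simp: inj_on_def doubleton_eq_iff)
qed

lemma undirected_Int_eq_empty:
  assumes "acyclic R" "A \<subseteq> R" "B \<subseteq> R" "A \<inter> B = {}"
  shows "undirected A \<inter> undirected B = {}"
  using inj_on_image_Int[OF inj_on_undirected[OF assms(1)] assms(2,3)] assms(4)
  by (simp add: undirected_def)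

inductive branching_from :: "'a set set \<Rightarrow> 'a set \<Rightarrow> ('a \<times> 'a) set \<Rightarrow> 'a set \<Rightarrow> bool"
  for E T where
  roots: "branching_from E T {} T"
| arc: "branching_from E T (insert (y, z) R) (insert z X)"
    if "branching_from E T R X" "y \<in> X" "z \<notin> X" "{y, z} \<in> E"

lemma branching_from_superset: "branching_from E T R X \<Longrightarrow> T \<subseteq> X"
  by (induction rule: branching_from.induct) auto

lemma Domain_branching_from: "branching_from E T R X \<Longrightarrow> Domain R \<subseteq> X"
  by (induction rule: branching_from.induct) auto

lemma Range_branching_from: "branching_from E T R X \<Longrightarrow> Range R = X - T"
proof (induction rule: branching_from.induct)
  case (arc R X y z)
  then show ?case using branching_from_superset[OF arc(1)] by auto
qed simp

lemma undirected_branching_from: "branching_from E T R X \<Longrightarrow> undirected R \<subseteq> E"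
  by (induction rule: branching_from.induct) auto

lemma branching_from_edges_mono:
  "branching_from E T R X \<Longrightarrow> undirected R \<subseteq> E' \<Longrightarrow> branching_from E' T R X"
  by (induction rule: branching_from.induct) (auto intro: branching_from.intros)

lemma connected_in_branching_from:
  "branching_from E T R X \<Longrightarrow> connected_in E T \<Longrightarrow> connected_in E X"
proof (induction rule: branching_from.induct)
  case (arc R X y z)
  then have "connected_in E (X \<union> {z})"
    by (intro connected_in_Un_neighbours) auto
  then show ?case by simp
qed

lemma card_branching_from:
  assumes "branching_from E T R X" "finite T"
  shows "finite R" "finite X" "card R + card T = card X"
proof -
  have "finite R \<and> finite X \<and> card R + card T = card X"
    using assms
  proof (induction rule: branching_from.induct)
    case (arc R X y z)
    then have "(y, z) \<notin> R" using Range_branching_from by blast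
    then show ?case using arc by simp
  qed simp
  then show "finite R" "finite X" "card R + card T = card X" by auto
qed

lemma single_valued_branching_from: "branching_from E T R X \<Longrightarrow> single_valued (R\<inverse>)"
proof (induction rule: branching_from.induct)
  case (arc R X y z)
  then have "z \<notin> Range R" using Range_branching_from by blast
  then show ?case using arc.IH by (auto simp: single_valued_def)
qed simp

lemma acyclic_branching_from: "branching_from E T R X \<Longrightarrow> acyclic R"
proof (induction rule: branching_from.induct)
  case (arc R X y z)
  then have "z \<notin> Domain R" "z \<noteq> y" using Domain_branching_from by blast+
  then have "(z, y) \<notin> R\<^sup>*" by (auto elim: converse_rtranclE)
  then show ?case using arc.IH by (simp add: acyclic_insert)
qed (simp add: acyclic_def)

lemma branching_from_irrefl: "branching_from E T R X \<Longrightarrow> (y, y) \<notin> R"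
  using acyclic_branching_from by (meson acyclic_def trancl.intros(1))

lemma branching_from_exists:
  assumes "connected_in E V" "finite V" "T \<subseteq> V" "T \<noteq> {}" "card T \<le> s" "s \<le> card V"
  obtains R X where "branching_from E T R X" "X \<subseteq> V" "card X = s"
proof -
  have "\<exists>R X. branching_from E T R X \<and> X \<subseteq> V \<and> card X = s"
    using assms(5,6)
  proof (induction s rule: dec_induct)
    case base
    show ?case using assms(3) branching_from.roots by blast
  next
    case (step s)
    then obtain R X where X: "branching_from E T R X" "X \<subseteq> V" "card X = s" by auto
    have "X \<noteq> {}" using branching_from_superset[OF X(1)] assms(4) by blast
    moreover have "X \<subset> V" using X step.prems by auto
    ultimately obtain y z where yz: "y \<in> X" "z \<in> V - X" "{y, z} \<in> E"
      by (rule connected_in_cut[OF assms(1)])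
    have "branching_from E T (insert (y, z) R) (insert z X)"
      using X(1) yz by (intro branching_from.arc) auto
    moreover have "insert z X \<subseteq> V" "card (insert z X) = Suc s"
      using X(2,3) yz(2) finite_subset[OF X(2) assms(2)] by auto
    ultimately show ?case by blast
  qed
  then show ?thesis using that by blast
qed

corollary spanning_branching_exists:
  assumes "connected_in E V" "finite V" "T \<subseteq> V" "T \<noteq> {}"
  obtains R where "branching_from E T R V"
proof -
  obtain R X where "branching_from E T R X" "X \<subseteq> V" "card X = card V"
    using branching_from_exists[OF assms card_mono[OF assms(2,3)] order.refl] .
  then show ?thesis using that card_subset_eq[OF assms(2)] by metis
qed

definition spanning_trees :: "'a set \<Rightarrow> 'a set set set" where
  "spanning_trees X = {F. F \<subseteq> all_edges X \<and> card F + 1 = card X \<and> connected_in F X}"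

lemma undirected_in_spanning_trees:
  assumes "branching_from E {r} R X"
  shows "undirected R \<in> spanning_trees X"
proof -
  have "undirected R \<subseteq> all_edges X"
    using Domain_branching_from[OF assms] Range_branching_from[OF assms]
      branching_from_irrefl[OF assms]
    by (fastforce simp: undirected_def all_edges_def card_2_iff)
  moreover have "card (undirected R) = card R"
    unfolding undirected_def
    by (intro card_image inj_on_undirected acyclic_branching_from[OF assms])
  then have "card (undirected R) + 1 = card X"
    using card_branching_from[OF assms] by simp
  moreover have "connected_in {} {r}"
    by (auto simp: connected_in_def)
  then have "connected_in (undirected R) {r}"
    by (rule connected_in_mono) simp
  then have "connected_in (undirected R) X"
    by (intro connected_in_branching_from[OF branching_from_edges_mono[OF assms]]) auto
  ultimately show ?thesis by (simp add: spanning_trees_def)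
qed

lemma subtree_exists:
  assumes "connected_in E V" "finite V" "1 \<le> s" "s \<le> card V"
  obtains T F where "T \<subseteq> V" "card T = s" "F \<in> spanning_trees T" "F \<subseteq> E"
proof -
  obtain r where "r \<in> V" using assms(3,4) by fastforce
  then obtain R X where X: "branching_from E {r} R X" "X \<subseteq> V" "card X = s"
    using branching_from_exists[OF assms(1,2), of "{r}" s] assms(3,4) by auto
  show ?thesis
    using X(2,3) undirected_in_spanning_trees[OF X(1)] undirected_branching_from[OF X(1)]
    by (rule that)
qed

corollary spanning_tree_exists:
  assumes "connected_in E X" "finite X" "X \<noteq> {}"
  obtains F where "F \<in> spanning_trees X" "F \<subseteq> E"
proof -
  have "1 \<le> card X" using assms(2,3) by (simp add: Suc_le_eq card_gt_0_iff)
  then obtain T F where T: "T \<subseteq> X" "card T = card X" "F \<in> spanning_trees T" "F \<subseteq> E"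
    by (rule subtree_exists[OF assms(1,2) _ order.refl])
  then have "T = X" using assms(2) by (intro card_subset_eq)
  then show ?thesis using that T(3,4) by simp
qed

definition parent_edges :: "'a set \<Rightarrow> ('a \<Rightarrow> 'a) \<Rightarrow> 'a set set" where
  "parent_edges X parent = {{parent z, z} | z. z \<in> X \<and> parent z \<noteq> z}"

lemma spanning_tree_parent_function:
  assumes "F \<in> spanning_trees X"
  shows "\<exists>parent \<in> X \<rightarrow>\<^sub>E X. F = parent_edges X parent"
proof -
  have F: "F \<subseteq> all_edges X" "card F + 1 = card X" "connected_in F X"
    using assms by (auto simp: spanning_trees_def)
  have "finite X" using F(2) by (intro card_ge_0_finite) simp
  then have "finite F" using F(1) finite_all_edges finite_subset by blast
  obtain r where "r \<in> X" using F(2) by fastforce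
  then obtain R where R: "branching_from F {r} R X"
    using spanning_branching_exists[OF F(3) \<open>finite X\<close>, of "{r}"] by auto
  have F_eq: "F = undirected R"
    using undirected_in_spanning_trees[OF R] undirected_branching_from[OF R] F(2) \<open>finite F\<close>
    by (intro card_subset_eq[symmetric]) (auto simp: spanning_trees_def)
  define parent where "parent = (\<lambda>z\<in>X. if z = r then r else THE y. (y, z) \<in> R)"
  have parent_eq: "parent z = y" if "(y, z) \<in> R" for y z
  proof -
    have "z \<in> X - {r}" using that Range_branching_from[OF R] by blast
    moreover have "(THE y. (y, z) \<in> R) = y"
      using that single_valued_branching_from[OF R] by (auto simp: single_valued_def)
    ultimately show ?thesis by (simp add: parent_def)
  qed
  have arc_iff: "(y, z) \<in> R \<longleftrightarrow> z \<in> X \<and> z \<noteq> r \<and> y = parent z" for y z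
    using Range_branching_from[OF R] parent_eq by blast
  have "parent r = r" using \<open>r \<in> X\<close> by (simp add: parent_def)
  have "F = parent_edges X parent"
    unfolding F_eq undirected_def parent_edges_def
    using branching_from_irrefl[OF R] \<open>parent r = r\<close>
    by (fastforce simp: arc_iff)
  moreover have "parent \<in> X \<rightarrow>\<^sub>E X"
  proof (intro PiE_I)
    fix z assume "z \<in> X"
    then show "parent z \<in> X"
      using \<open>r \<in> X\<close> Domain_branching_from[OF R] arc_iff[of "parent z" z] \<open>parent r = r\<close>
      by (cases "z = r") auto
  qed (simp add: parent_def)
  ultimately show ?thesis by blast
qed

lemma card_spanning_trees:
  assumes "finite X"
  shows "finite (spanning_trees X)" "card (spanning_trees X) \<le> card X ^ card X"
proof -
  have sub: "spanning_trees X \<subseteq> parent_edges X ` (X \<rightarrow>\<^sub>E X)"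
    using spanning_tree_parent_function by blast
  have fin: "finite (X \<rightarrow>\<^sub>E X)" using assms by (intro finite_PiE) auto
  show "finite (spanning_trees X)"
    using finite_surj[OF fin sub] .
  have "card (spanning_trees X) \<le> card (X \<rightarrow>\<^sub>E X)"
    by (rule surj_card_le[OF fin sub])
  then show "card (spanning_trees X) \<le> card X ^ card X"
    using assms by (simp add: card_funcsetE)
qed

lemma sum_vertex_degree:
  assumes "finite V" "F \<subseteq> all_edges V"
  shows "(\<Sum>v\<in>V. vertex_degree F v) = 2 * card F"
proof -
  have "finite F" using assms finite_all_edges finite_subset by blast
  have "(\<Sum>v\<in>V. vertex_degree F v) = (\<Sum>e\<in>F. card {v \<in> V. v \<in> e})"
    unfolding vertex_degree_def using assms(1) \<open>finite F\<close> by (intro sum_multicount_gen) auto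
  also have "\<dots> = (\<Sum>e\<in>F. 2)"
  proof (intro sum.cong refl)
    fix e assume "e \<in> F"
    then have "{v \<in> V. v \<in> e} = e" "card e = 2" using assms(2) by (auto simp: all_edges_def)
    then show "card {v \<in> V. v \<in> e} = 2" by simp
  qed
  finally show ?thesis by simp
qed

lemma card_low_degree_vertices:
  assumes "finite V" "F \<subseteq> all_edges V" "card F < card V"
  shows "card V \<le> 3 * card {v \<in> V. vertex_degree F v \<le> 2}"
proof -
  define low where "low = {v \<in> V. vertex_degree F v \<le> 2}"
  have "3 * card (V - low) = (\<Sum>v\<in>V - low. 3)" by simp
  also have "\<dots> \<le> (\<Sum>v\<in>V - low. vertex_degree F v)" by (intro sum_mono) (auto simp: low_def)
  also have "\<dots> \<le> (\<Sum>v\<in>V. vertex_degree F v)" using assms(1) by (intro sum_mono2) auto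
  also have "\<dots> = 2 * card F" by (rule sum_vertex_degree[OF assms(1,2)])
  finally have "3 * card (V - low) < 2 * card V" using assms(3) by linarith
  moreover have "card (V - low) = card V - card low"
    using assms(1) by (intro card_Diff_subset) (auto simp: low_def)
  ultimately have "card V \<le> 3 * card low" by linarith
  then show ?thesis by (simp add: low_def)
qed

section \<open>Witnesses for survival\<close>

primrec tree_witnesses :: "nat \<Rightarrow> 'a set \<Rightarrow> nat \<Rightarrow> 'a \<Rightarrow> 'a set set set" where
  "tree_witnesses k V 0 = (\<lambda>v. {{}})"
| "tree_witnesses k V (Suc t) = (\<lambda>v. {\<Union>(f ` N) | f N. N \<subseteq> V \<and> card N = k - 1 \<and>
     (\<forall>w\<in>N. f w \<in> pendant {v, w} (tree_witnesses k V t w)) \<and> disjoint_family_on f N})"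

definition hanging_witnesses :: "nat \<Rightarrow> 'a set \<Rightarrow> nat \<Rightarrow> 'a \<Rightarrow> 'a set set set" where
  "hanging_witnesses k V t v = (\<Union>w\<in>V. pendant {v, w} (tree_witnesses k V t w))"

text \<open>\<open>S i\<close> stands for the vertices, or for enough of them, that survive \<open>i\<close> rounds of peeling.\<close>

definition survival_layers :: "nat \<Rightarrow> 'a set \<Rightarrow> 'a set set \<Rightarrow> nat \<Rightarrow> (nat \<Rightarrow> 'a set) \<Rightarrow> bool" where
  "survival_layers k V E t S \<longleftrightarrow>
    (\<forall>i. S i \<subseteq> V) \<and> (\<forall>i<t. \<forall>v\<in>S (Suc i). k \<le> card {w \<in> S i. {v, w} \<in> E})"

lemma survival_layers_Suc:
  "survival_layers k V E (Suc t) S \<longleftrightarrow>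
    survival_layers k V E t S \<and> (\<forall>v\<in>S (Suc t). k \<le> card {w \<in> S t. {v, w} \<in> E})"
  by (auto simp: survival_layers_def less_Suc_eq)

lemma survival_layers_subset: "survival_layers k V E t S \<Longrightarrow> S i \<subseteq> V"
  by (simp add: survival_layers_def)

definition branch :: "('a \<times> 'a) set \<Rightarrow> 'a \<Rightarrow> ('a \<times> 'a) set" where
  "branch R w = {(y, z) \<in> R. (w, z) \<in> R\<^sup>*}"

definition arcs_below :: "('a \<times> 'a) set \<Rightarrow> 'a \<Rightarrow> ('a \<times> 'a) set" where
  "arcs_below R w = {(y, z) \<in> R. (w, z) \<in> R\<^sup>+}"

lemma branch_disjoint:
  assumes "single_valued (R\<inverse>)" "(x, w) \<in> R" "(x', w') \<in> R" "w \<noteq> w'"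
    and "(w, x') \<notin> R\<^sup>*" "(w', x) \<notin> R\<^sup>*"
  shows "branch R w \<inter> branch R w' = {}"
proof -
  have unrelated: "(u, u') \<notin> R\<^sup>*"
    if "(y, u') \<in> R" "u \<noteq> u'" "(u, y) \<notin> R\<^sup>*" for u u' y
  proof
    assume "(u, u') \<in> R\<^sup>*"
    with that(2) obtain y' where "(u, y') \<in> R\<^sup>*" "(y', u') \<in> R"
      by (meson rtranclE)
    then show False using assms(1) that(1,3) by (auto simp: single_valued_def)
  qed
  have False if "(w, z) \<in> R\<^sup>*" "(w', z) \<in> R\<^sup>*" for z
    using single_valued_confluent[OF assms(1), of z w w'] that
      unrelated[OF assms(3,4,5)] unrelated[OF assms(2) assms(4)[symmetric] assms(6)]
    by (simp add: rtrancl_converse)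
  then show ?thesis by (auto simp: branch_def)
qed

lemma disjoint_family_on_branches:
  assumes "acyclic R" "single_valued (R\<inverse>)" "inj_on child J"
    and "\<And>v. v \<in> J \<Longrightarrow> (parent v, child v) \<in> R"
    and "\<And>u v. u \<in> J \<Longrightarrow> v \<in> J \<Longrightarrow> (child u, parent v) \<notin> R\<^sup>*"
    and "\<And>v. v \<in> J \<Longrightarrow> W v \<subseteq> undirected (branch R (child v))"
  shows "disjoint_family_on W J"
  unfolding disjoint_family_on_def
proof (intro ballI impI)
  fix u v assume uv: "u \<in> J" "v \<in> J" "u \<noteq> v"
  then have "child u \<noteq> child v"
    using assms(3) by (auto dest: inj_onD)
  then have "branch R (child u) \<inter> branch R (child v) = {}"
    using uv assms(5) by (intro branch_disjoint[OF assms(2) assms(4) assms(4)]) auto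
  then have "undirected (branch R (child u)) \<inter> undirected (branch R (child v)) = {}"
    by (intro undirected_Int_eq_empty[OF assms(1)]) (auto simp: branch_def)
  then show "W u \<inter> W v = {}" using assms(6) uv(1,2) by blast
qed

lemma pendant_in_branch:
  assumes "acyclic R" "(x, w) \<in> R" "W \<in> \<W>" "W \<subseteq> undirected (arcs_below R w)"
  shows "insert {x, w} W \<in> pendant {x, w} \<W>" "insert {x, w} W \<subseteq> undirected (branch R w)"
proof -
  have "(w, w) \<notin> R\<^sup>+" using assms(1) by (simp add: acyclic_def)
  then have "undirected {(x, w)} \<inter> undirected (arcs_below R w) = {}"
    using assms(1,2) by (intro undirected_Int_eq_empty) (auto simp: arcs_below_def)
  then have "{x, w} \<notin> W" using assms(4) by auto
  then show "insert {x, w} W \<in> pendant {x, w} \<W>"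
    using assms(3) by (auto simp: pendant_def)
  have "undirected (arcs_below R w) \<subseteq> undirected (branch R w)"
    by (intro undirected_mono) (auto simp: branch_def arcs_below_def)
  moreover have "undirected {(x, w)} \<subseteq> undirected (branch R w)"
    using assms(2) by (intro undirected_mono) (auto simp: branch_def)
  ultimately show "insert {x, w} W \<subseteq> undirected (branch R w)"
    using assms(4) by auto
qed

lemma neighbour_outside_edges:
  assumes "finite F" "vertex_degree F v < card N"
  shows "\<exists>w\<in>N. {v, w} \<notin> F"
proof (rule ccontr)
  assume all_in_F: "\<not> ?thesis"
  have "inj_on (\<lambda>w. {v, w}) N"
    by (auto simp: inj_on_def doubleton_eq_iff)
  moreover have "(\<lambda>w. {v, w}) ` N \<subseteq> {e \<in> F. v \<in> e}"
    using all_in_F by auto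
  moreover have "finite {e \<in> F. v \<in> e}"
    using assms(1) by simp
  ultimately have "card N \<le> vertex_degree F v"
    unfolding vertex_degree_def by (rule card_inj_on_le)
  then show False using assms(2) by simp
qed

lemma card_children_ge:
  assumes "single_valued (R\<inverse>)" "finite N" "\<And>w. w \<in> N \<Longrightarrow> {x, w} \<in> undirected R"
  shows "card N - 1 \<le> card {w \<in> N. (x, w) \<in> R}"
proof -
  let ?parents = "{w \<in> N. (w, x) \<in> R}"
  have "N \<subseteq> {w \<in> N. (x, w) \<in> R} \<union> ?parents"
    using assms(3) by (auto elim: undirectedE)
  then have "card N \<le> card ({w \<in> N. (x, w) \<in> R} \<union> ?parents)"
    using assms(2) by (intro card_mono) auto
  also have "\<dots> \<le> card {w \<in> N. (x, w) \<in> R} + card ?parents"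
    by (rule card_Un_le)
  also have "card ?parents \<le> Suc 0"
    using assms(1,2) by (subst card_le_Suc0_iff_eq) (auto simp: single_valued_def)
  finally show ?thesis by simp
qed

lemma tree_witness_Suc_in_branching:
  assumes acyclic: "acyclic R" and single_valued: "single_valued (R\<inverse>)"
    and "N \<subseteq> V" "card N = k - 1" and arc: "\<And>w. w \<in> N \<Longrightarrow> (x, w) \<in> R"
    and "\<And>w. w \<in> N \<Longrightarrow> \<exists>W\<in>tree_witnesses k V t w. W \<subseteq> undirected (arcs_below R w)"
  shows "\<exists>W\<in>tree_witnesses k V (Suc t) x. W \<subseteq> undirected (arcs_below R x)"
proof -
  have "\<forall>w\<in>N. \<exists>W. W \<in> tree_witnesses k V t w \<and> W \<subseteq> undirected (arcs_below R w)"
    using assms(6) by (simp add: Bex_def)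
  from bchoice[OF this] obtain W where W: "\<And>w. w \<in> N \<Longrightarrow> W w \<in> tree_witnesses k V t w"
    "\<And>w. w \<in> N \<Longrightarrow> W w \<subseteq> undirected (arcs_below R w)"
    by blast
  define f where "f w = insert {x, w} (W w)" for w
  have f: "f w \<in> pendant {x, w} (tree_witnesses k V t w)" "f w \<subseteq> undirected (branch R w)"
    if "w \<in> N" for w
    using pendant_in_branch[OF acyclic arc[OF that] W[OF that]] by (simp_all add: f_def)
  have "(u, x) \<notin> R\<^sup>*" if "u \<in> N" for u
    using arc[OF that] acyclic by (meson acyclic_def rtrancl_into_trancl1)
  then have "disjoint_family_on f N"
    using arc f(2)
    by (intro disjoint_family_on_branches[OF acyclic single_valued, of "\<lambda>w. w" N "\<lambda>_. x"]) auto
  then have "\<Union>(f ` N) \<in> tree_witnesses k V (Suc t) x"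
    using assms(3,4) f(1) by auto
  moreover have "\<Union>(f ` N) \<subseteq> undirected (arcs_below R x)"
  proof (intro UN_least)
    fix w assume "w \<in> N"
    have "branch R w \<subseteq> arcs_below R x"
      using arc[OF \<open>w \<in> N\<close>] by (auto simp: branch_def arcs_below_def intro: rtrancl_into_trancl2)
    then show "f w \<subseteq> undirected (arcs_below R x)"
      using f(2)[OF \<open>w \<in> N\<close>] undirected_mono by blast
  qed
  ultimately show ?thesis by blast
qed

lemma tree_witness_in_branching:
  assumes acyclic: "acyclic R" and single_valued: "single_valued (R\<inverse>)" and "finite V"
    and "survival_layers k V E t S" "x \<in> S t"
    and "\<And>y z. (x, y) \<in> R\<^sup>* \<Longrightarrow> {y, z} \<in> E \<Longrightarrow> {y, z} \<in> undirected R"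
  shows "\<exists>W\<in>tree_witnesses k V t x. W \<subseteq> undirected (arcs_below R x)"
  using assms(4-6)
proof (induction t arbitrary: x)
  case (Suc t)
  note layers = Suc.prems(1)[unfolded survival_layers_Suc] and only_arcs = Suc.prems(3)
  have "S t \<subseteq> V" using layers survival_layers_subset by blast
  let ?neighbours = "{w \<in> S t. {x, w} \<in> E}"
  have "k - 1 \<le> card ?neighbours - 1"
    using layers Suc.prems(2) by (intro diff_le_mono) simp
  also have "\<dots> \<le> card {w \<in> ?neighbours. (x, w) \<in> R}"
    using finite_subset[OF \<open>S t \<subseteq> V\<close> \<open>finite V\<close>] only_arcs
    by (intro card_children_ge single_valued) auto
  finally obtain N where N: "N \<subseteq> {w \<in> ?neighbours. (x, w) \<in> R}" "card N = k - 1"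
    by (meson obtain_subset_with_card_n)
  have "\<exists>W\<in>tree_witnesses k V t w. W \<subseteq> undirected (arcs_below R w)" if "w \<in> N" for w
  proof (rule Suc.IH)
    have arc: "(x, w) \<in> R" using that N(1) by auto
    show "{y, z} \<in> undirected R" if "(w, y) \<in> R\<^sup>*" "{y, z} \<in> E" for y z
      using that only_arcs arc by (blast intro: converse_rtrancl_into_rtrancl)
    show "w \<in> S t" using that N(1) by auto
  qed (use layers in simp)
  then show ?case
    using N \<open>S t \<subseteq> V\<close> by (intro tree_witness_Suc_in_branching[OF acyclic single_valued, of N]) auto
qed auto

locale extended_spanning_tree =
  fixes V X T :: "'a set" and E F :: "'a set set" and R :: "('a \<times> 'a) set"
  assumes finite_V: "finite V" and subset_V: "X \<subseteq> V" and edges: "E \<subseteq> all_edges X"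
    and tree: "F \<in> spanning_trees T" "F \<subseteq> E"
    and branching: "branching_from E T R X"
begin

definition surplus :: "'a set set" where
  "surplus = E - (F \<union> undirected R)"

definition touched :: "'a \<Rightarrow> bool" where
  "touched v \<longleftrightarrow> (\<exists>y\<in>\<Union>surplus. (v, y) \<in> R\<^sup>*)"

lemma finite_X: "finite X"
  using finite_subset[OF subset_V finite_V] .

lemma finite_T: "finite T"
  using finite_subset[OF branching_from_superset[OF branching] finite_X] .

lemma acyclic_R: "acyclic R"
  and single_valued_R: "single_valued (R\<inverse>)"
  and no_arc_into_T: "(y, z) \<in> R \<Longrightarrow> z \<notin> T"
  using acyclic_branching_from[OF branching] single_valued_branching_from[OF branching]
    Range_branching_from[OF branching] by auto

lemma finite_edges: "finite E"
  using edges finite_X finite_all_edges finite_subset by blast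

lemma rtrancl_into_T_iff: "v \<in> T \<Longrightarrow> (u, v) \<in> R\<^sup>* \<longleftrightarrow> u = v"
  using no_arc_into_T by (auto elim: rtranclE)

lemma F_Int_undirected_R: "F \<inter> undirected R = {}"
  using tree(1) no_arc_into_T by (auto simp: spanning_trees_def all_edges_def undirected_def)

lemma card_surplus: "card surplus + card X = card E + 1"
proof -
  have "card (F \<union> undirected R) = card F + card (undirected R)"
    using tree(2) undirected_branching_from[OF branching] finite_edges F_Int_undirected_R
    by (intro card_Un_disjoint) (auto intro: finite_subset)
  also have "card (undirected R) = card R"
    unfolding undirected_def by (intro card_image inj_on_undirected acyclic_R)
  finally have "card (F \<union> undirected R) + 1 = card X"
    using tree(1) card_branching_from[OF branching finite_T] by (simp add: spanning_trees_def)
  moreover have "F \<union> undirected R \<subseteq> E"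
    using tree(2) undirected_branching_from[OF branching] by simp
  then have "card (E - (F \<union> undirected R)) + card (F \<union> undirected R) = card E"
    using finite_edges by (metis card_Diff_subset card_mono finite_subset le_add_diff_inverse2)
  ultimately show ?thesis by (simp add: surplus_def)
qed

lemma card_touched_le: "card {v \<in> T. touched v} \<le> 2 * card surplus"
proof -
  have "\<Union>surplus \<subseteq> X"
    using edges unfolding surplus_def all_edges_def by blast
  then have "finite (\<Union>surplus)"
    using finite_X finite_subset by blast
  then have "card {v \<in> T. touched v} \<le> card (\<Union>surplus)"
  proof (rule card_le_if_inj_on_rel[where r = "\<lambda>v y. (v, y) \<in> R\<^sup>*"])
    fix u v y assume "u \<in> {v \<in> T. touched v}" "v \<in> {v \<in> T. touched v}" "(u, y) \<in> R\<^sup>*" "(v, y) \<in> R\<^sup>*"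
    then show "u = v"
      using single_valued_confluent[OF single_valued_R, of y u v]
      by (auto simp: rtrancl_converse rtrancl_into_T_iff)
  qed (auto simp: touched_def)
  also have "\<dots> \<le> (\<Sum>e\<in>surplus. card e)"
    by (rule card_Union_le_sum_card)
  also have "\<dots> = (\<Sum>e\<in>surplus. 2)"
    using edges by (intro sum.cong) (auto simp: surplus_def all_edges_def)
  finally show ?thesis by simp
qed

lemma untouched_branch_witness:
  assumes "v \<in> T" "\<not> touched v" "vertex_degree F v < k"
    and "survival_layers k V E (Suc t) S" "v \<in> S (Suc t)"
  shows "\<exists>w W. (v, w) \<in> R \<and> W \<in> pendant {v, w} (tree_witnesses k V t w) \<and>
    W \<subseteq> undirected (branch R w)"
proof -
  have tree_edge: "{y, z} \<in> F \<or> {y, z} \<in> undirected R" if "(v, y) \<in> R\<^sup>*" "{y, z} \<in> E" for y z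
    using assms(2) that unfolding touched_def surplus_def by blast
  have "vertex_degree F v < card {w \<in> S t. {v, w} \<in> E}"
    using assms(3-5) by (auto simp: survival_layers_Suc intro: less_le_trans)
  then have "\<exists>w\<in>{w \<in> S t. {v, w} \<in> E}. {v, w} \<notin> F"
    by (rule neighbour_outside_edges[OF finite_subset[OF tree(2) finite_edges]])
  then obtain w where w: "w \<in> S t" "{v, w} \<in> E" "{v, w} \<notin> F" by blast
  then have arc: "(v, w) \<in> R"
    using tree_edge[of v w] no_arc_into_T assms(1) by (auto elim: undirectedE)
  have "{y, z} \<in> undirected R" if "(w, y) \<in> R\<^sup>*" "{y, z} \<in> E" for y z
  proof -
    have "(v, y) \<in> R\<^sup>*" using arc that(1) by (rule converse_rtrancl_into_rtrancl)
    moreover have "y \<notin> T"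
      using that(1) rtrancl_into_T_iff[of y w] no_arc_into_T[OF arc] by blast
    then have "{y, z} \<notin> F" using tree(1) by (auto simp: spanning_trees_def all_edges_def)
    ultimately show ?thesis using tree_edge that(2) by blast
  qed
  moreover have "survival_layers k V E t S" using assms(4) by (simp add: survival_layers_Suc)
  ultimately obtain W where "W \<in> tree_witnesses k V t w" "W \<subseteq> undirected (arcs_below R w)"
    using tree_witness_in_branching[OF acyclic_R single_valued_R finite_V] w(1) by blast
  then show ?thesis
    using arc pendant_in_branch[OF acyclic_R arc] by blast
qed

lemma hanging_witnesses_occur_disjointly:
  assumes "survival_layers k V E (Suc t) S" "J \<subseteq> T \<inter> S (Suc t)"
    and "\<And>v. v \<in> J \<Longrightarrow> vertex_degree F v < k" "\<And>v. v \<in> J \<Longrightarrow> \<not> touched v"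
  shows "occur_disjointly {J} (hanging_witnesses k V t) (E - F)"
proof -
  have "\<forall>v\<in>J. \<exists>w W. (v, w) \<in> R \<and> W \<in> pendant {v, w} (tree_witnesses k V t w) \<and>
      W \<subseteq> undirected (branch R w)"
    using assms(2-4) by (intro ballI untouched_branch_witness[OF _ _ _ assms(1)]) auto
  then obtain child W where W: "\<And>v. v \<in> J \<Longrightarrow> (v, child v) \<in> R"
    "\<And>v. v \<in> J \<Longrightarrow> W v \<in> pendant {v, child v} (tree_witnesses k V t (child v))"
    "\<And>v. v \<in> J \<Longrightarrow> W v \<subseteq> undirected (branch R (child v))"
    by metis
  have "W v \<in> hanging_witnesses k V t v" if "v \<in> J" for v
    using W(1,2)[OF that] Range_branching_from[OF branching] subset_V
    by (auto simp: hanging_witnesses_def)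
  moreover have "W v \<subseteq> E - F" if "v \<in> J" for v
  proof -
    have "undirected (branch R (child v)) \<subseteq> undirected R"
      by (intro undirected_mono) (auto simp: branch_def)
    then show ?thesis
      using W(3)[OF that] F_Int_undirected_R undirected_branching_from[OF branching] by blast
  qed
  moreover have "disjoint_family_on W J"
  proof (rule disjoint_family_on_branches[OF acyclic_R single_valued_R])
    show "inj_on child J"
      using W(1) single_valued_R by (auto simp: inj_on_def single_valued_def) (metis)
    show "(child u, v) \<notin> R\<^sup>*" if "u \<in> J" "v \<in> J" for u v
      using rtrancl_into_T_iff[of v "child u"] no_arc_into_T[OF W(1)[OF that(1)]] assms(2) that(2)
      by auto
  qed (use W in auto)
  ultimately show ?thesis by (auto simp: occur_disjointly_def)
qed

corollary disjoint_hanging_witnesses_exist: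
  assumes "survival_layers k V E (Suc t) S" "I \<subseteq> T \<inter> S (Suc t)"
    and "\<And>v. v \<in> I \<Longrightarrow> vertex_degree F v < k"
  obtains J where "J \<subseteq> I" "card I \<le> card J + 2 * card surplus"
    "occur_disjointly {J} (hanging_witnesses k V t) (E - F)"
proof -
  let ?J = "{v \<in> I. \<not> touched v}"
  have "I \<subseteq> T" using assms(2) by blast
  then have "card I \<le> card (?J \<union> {v \<in> T. touched v})"
    using finite_T by (intro card_mono) (auto intro: finite_subset)
  also have "\<dots> \<le> card ?J + card {v \<in> T. touched v}"
    by (rule card_Un_le)
  also have "\<dots> \<le> card ?J + 2 * card surplus"
    using card_touched_le by simp
  finally have "card I \<le> card ?J + 2 * card surplus" .
  moreover have "occur_disjointly {?J} (hanging_witnesses k V t) (E - F)"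
    using assms by (intro hanging_witnesses_occur_disjointly[OF assms(1)]) auto
  ultimately show ?thesis using that[of ?J] by blast
qed

end

lemma survival_layers_mono: "survival_layers k X E t S \<Longrightarrow> X \<subseteq> V \<Longrightarrow> survival_layers k V E t S"
  by (auto simp: survival_layers_def)

lemma survival_layers_induced:
  assumes "survival_layers k X E t S"
  shows "survival_layers k X (induced E X) t S"
proof -
  have "{w \<in> S i. {v, w} \<in> induced E X} = {w \<in> S i. {v, w} \<in> E}" if "v \<in> S (Suc i)" for v i
    using survival_layers_subset[OF assms] that by (auto simp: induced_def)
  then show ?thesis using assms by (simp add: survival_layers_def)
qed

primrec complete_tree_size :: "nat \<Rightarrow> nat \<Rightarrow> nat" where
  "complete_tree_size k 0 = 1"
| "complete_tree_size k (Suc t) = 1 + k * complete_tree_size k t"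

lemma sparse_layer_exists:
  assumes "finite I" "finite S" "\<And>v. v \<in> I \<Longrightarrow> k \<le> card {w \<in> S. {v, w} \<in> E}"
  obtains I' where "I' \<subseteq> S" "card I' \<le> card I * k" "\<And>v. v \<in> I \<Longrightarrow> k \<le> card {w \<in> I'. {v, w} \<in> E}"
    "\<And>w. w \<in> I' \<Longrightarrow> \<exists>v\<in>I. {v, w} \<in> E"
proof -
  have "\<forall>v\<in>I. \<exists>N. N \<subseteq> {w \<in> S. {v, w} \<in> E} \<and> card N = k"
    using assms(3) by (intro ballI ex_card)
  from bchoice[OF this] obtain N
    where N: "\<And>v. v \<in> I \<Longrightarrow> N v \<subseteq> {w \<in> S. {v, w} \<in> E}" "\<And>v. v \<in> I \<Longrightarrow> card (N v) = k"
    by blast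
  have "card (\<Union>(N ` I)) \<le> (\<Sum>v\<in>I. card (N v))"
    using assms(1) by (rule card_UN_le)
  then have "card (\<Union>(N ` I)) \<le> card I * k"
    using N(2) by simp
  moreover have sub: "\<Union>(N ` I) \<subseteq> S" using N(1) by blast
  moreover have "k \<le> card {w \<in> \<Union>(N ` I). {v, w} \<in> E}" if "v \<in> I" for v
  proof -
    have "finite {w \<in> \<Union>(N ` I). {v, w} \<in> E}"
      by (rule finite_subset[OF _ assms(2)]) (use sub in blast)
    then show ?thesis
      using N[OF that] that card_mono[of "{w \<in> \<Union>(N ` I). {v, w} \<in> E}" "N v"] by blast
  qed
  ultimately show ?thesis using that[of "\<Union>(N ` I)"] N(1) by blast
qed

lemma sparse_survival_layers_exist:
  assumes "finite V" "survival_layers k V E t S" "T \<subseteq> V" "connected_in E T" "I \<subseteq> T" "I \<subseteq> S t"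
  shows "\<exists>X S'. T \<subseteq> X \<and> X \<subseteq> V \<and> connected_in E X \<and>
    card X + card I \<le> card T + card I * complete_tree_size k t \<and>
    survival_layers k X E t S' \<and> S' t = I"
  using assms(2-)
proof (induction t arbitrary: T I)
  case 0
  then show ?case
    by (intro exI[of _ T] exI[of _ "\<lambda>_. I"]) (simp add: survival_layers_def)
next
  case (Suc t)
  note layers = Suc.prems(1)[unfolded survival_layers_Suc]
  have "S t \<subseteq> V" using layers survival_layers_subset by blast
  have "finite I" using finite_subset[OF Suc.prems(4) finite_subset[OF Suc.prems(2) assms(1)]] .
  moreover have "finite (S t)" using finite_subset[OF \<open>S t \<subseteq> V\<close> assms(1)] .
  moreover have "k \<le> card {w \<in> S t. {v, w} \<in> E}" if "v \<in> I" for v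
    using layers Suc.prems(5) that by blast
  ultimately obtain I' where I': "I' \<subseteq> S t" "card I' \<le> card I * k"
      "\<And>v. v \<in> I \<Longrightarrow> k \<le> card {w \<in> I'. {v, w} \<in> E}" "\<And>w. w \<in> I' \<Longrightarrow> \<exists>v\<in>I. {v, w} \<in> E"
    using sparse_layer_exists[of I "S t" k E] by blast
  have "connected_in E (T \<union> I')"
    using I'(4) Suc.prems(3,4) by (intro connected_in_Un_neighbours) auto
  moreover have "T \<union> I' \<subseteq> V" using Suc.prems(2) I'(1) \<open>S t \<subseteq> V\<close> by blast
  ultimately obtain X S' where X: "T \<union> I' \<subseteq> X" "X \<subseteq> V" "connected_in E X"
      "card X + card I' \<le> card (T \<union> I') + card I' * complete_tree_size k t"
      "survival_layers k X E t S'" "S' t = I'"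
    using Suc.IH[of "T \<union> I'" I'] layers I'(1) by blast
  have "card X \<le> card T + card I' * complete_tree_size k t"
    using X(4) card_Un_le[of T I'] by linarith
  also have "\<dots> \<le> card T + card I * k * complete_tree_size k t"
    using I'(2) by (intro add_left_mono mult_right_mono) auto
  finally have "card X + card I \<le> card T + card I * complete_tree_size k (Suc t)"
    by (simp add: algebra_simps)
  moreover have "survival_layers k X E (Suc t) (S'(Suc t := I))"
    using X(1,5,6) I'(3) Suc.prems(4) by (auto simp: survival_layers_def less_Suc_eq)
  moreover have "(S'(Suc t := I)) (Suc t) = I" by simp
  ultimately show ?case using X(1-3) by blast
qed

section \<open>Components of the peeled graph\<close>

lemma peel_subset: "peel k E t \<subseteq> E"
  by (induction t) (auto simp: peel_step_def)

lemma survival_layers_peel: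
  assumes "finite V" "E \<subseteq> all_edges V"
  shows "survival_layers k V E t (\<lambda>i. \<Union>(peel k E i))"
  unfolding survival_layers_def
proof (intro conjI allI impI ballI)
  show "\<Union>(peel k E i) \<subseteq> V" for i
    using peel_subset[of k E i] assms(2) by (auto simp: all_edges_def)
  fix i v assume v: "v \<in> \<Union>(peel k E (Suc i))"
  let ?P = "peel k E i"
  have "\<not> vertex_degree ?P v \<le> k - 1"
    using v by (auto simp: peel_step_def)
  then have "k \<le> card {e \<in> ?P. v \<in> e}"
    by (simp add: vertex_degree_def)
  also have "\<dots> \<le> card {w \<in> \<Union>?P. {v, w} \<in> E}"
  proof (rule surj_card_le)
    show "finite {w \<in> \<Union>?P. {v, w} \<in> E}"
      using assms by (auto intro!: finite_subset[of _ V] simp: all_edges_def)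
    show "{e \<in> ?P. v \<in> e} \<subseteq> (\<lambda>w. {v, w}) ` {w \<in> \<Union>?P. {v, w} \<in> E}"
    proof
      fix e assume e: "e \<in> {e \<in> ?P. v \<in> e}"
      then have "e \<in> E" using peel_subset by blast
      then have "card e = 2" using assms(2) by (auto simp: all_edges_def)
      then obtain w where "e = {v, w}" using e by (auto simp: card_2_iff)
      then show "e \<in> (\<lambda>w. {v, w}) ` {w \<in> \<Union>?P. {v, w} \<in> E}" using e \<open>e \<in> E\<close> by blast
    qed
  qed
  finally show "k \<le> card {w \<in> \<Union>?P. {v, w} \<in> E}" .
qed

lemma graph_componentE:
  assumes "C \<in> graph_components V P"
  obtains r where "r \<in> V" "C = {(u, v). {u, v} \<in> P}\<^sup>* `` {r}"
  using assms by (auto simp: graph_components_def quotient_def)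

lemma graph_component_path:
  assumes "C \<in> graph_components V P" "u \<in> C"
  shows "v \<in> C \<longleftrightarrow> (u, v) \<in> {(u, v). {u, v} \<in> P}\<^sup>*"
proof -
  let ?adj = "{(u, v). {u, v} \<in> P}"
  obtain r where C: "C = ?adj\<^sup>* `` {r}"
    by (rule graph_componentE[OF assms(1)])
  have "sym ?adj" by (auto simp: sym_def insert_commute)
  then have "(u, r) \<in> ?adj\<^sup>*"
    using C assms(2) by (meson Image_singleton_iff sym_rtrancl symD)
  then show ?thesis
    using C assms(2) by (auto intro: rtrancl_trans)
qed

lemma graph_component_subset:
  assumes "C \<in> graph_components V P" "P \<subseteq> all_edges V"
  shows "C \<subseteq> V"
proof -
  obtain r where r: "r \<in> V" "C = {(u, v). {u, v} \<in> P}\<^sup>* `` {r}"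
    by (rule graph_componentE[OF assms(1)])
  have "v \<in> V" if "(u, v) \<in> {(u, v). {u, v} \<in> P}" for u v
    using that assms(2) by (auto simp: all_edges_def)
  then show ?thesis using r by (auto elim: rtranclE)
qed

lemma connected_in_graph_component:
  assumes "C \<in> graph_components V P"
  shows "connected_in P C"
  unfolding connected_in_def
proof (intro allI impI, rule ccontr)
  fix Y assume Y: "Y \<noteq> {}" "Y \<subset> C" and closed: "\<not> (\<exists>y\<in>Y. \<exists>z\<in>C - Y. {y, z} \<in> P)"
  obtain y z where yz: "y \<in> Y" "z \<in> C" "z \<notin> Y" using Y by blast
  have "(y, z) \<in> {(u, v). {u, v} \<in> P}\<^sup>*"
    using graph_component_path[OF assms, of y z] yz Y(2) by auto
  then have "z \<in> Y"
  proof (induction rule: rtrancl_induct)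
    case (step u v)
    then have "v \<in> C"
      using graph_component_path[OF assms, of u v] Y(2) by auto
    then show ?case using closed step by auto
  qed (rule yz(1))
  then show False using yz(3) by simp
qed

lemma nontrivial_graph_component_subset:
  assumes "C \<in> graph_components V P" "2 \<le> card C"
  shows "C \<subseteq> \<Union>P"
proof
  fix u assume "u \<in> C"
  have "C \<noteq> {u}" using assms(2) by auto
  then obtain v where "v \<in> C" "v \<noteq> u" using \<open>u \<in> C\<close> by blast
  then have "(u, v) \<in> {(u, v). {u, v} \<in> P}\<^sup>*"
    using graph_component_path[OF assms(1) \<open>u \<in> C\<close>] by simp
  then obtain w where "{u, w} \<in> P" using \<open>v \<noteq> u\<close> by (auto elim: converse_rtranclE)
  then show "u \<in> \<Union>P" by blast
qed

lemma occur_disjointly_mono: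
  assumes "occur_disjointly \<J> \<W> E" "E \<subseteq> E'"
  shows "occur_disjointly \<J> \<W> E'"
proof -
  obtain J W where "J \<in> \<J>" "\<forall>j\<in>J. W j \<in> \<W> j \<and> W j \<subseteq> E" "disjoint_family_on W J"
    using assms(1) by (auto simp: occur_disjointly_def)
  with assms(2) show ?thesis
    unfolding occur_disjointly_def by (intro bexI[of _ J] exI[of _ W]) auto
qed

definition has_decorated_tree :: "nat \<Rightarrow> 'a set \<Rightarrow> nat \<Rightarrow> nat \<Rightarrow> nat \<Rightarrow> 'a set set \<Rightarrow> bool" where
  "has_decorated_tree k V t s m E \<longleftrightarrow>
    (\<exists>T\<in>{T. T \<subseteq> V \<and> card T = s}. \<exists>F\<in>spanning_trees T. \<exists>J\<in>{J. J \<subseteq> T \<and> s \<le> 3 * (card J + 2 * m)}.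
      F \<subseteq> E \<and> occur_disjointly {J} (hanging_witnesses k V t) (E - F))"

definition has_excess_subgraph :: "'a set \<Rightarrow> nat \<Rightarrow> nat \<Rightarrow> 'a set set \<Rightarrow> bool" where
  "has_excess_subgraph V L m E \<longleftrightarrow>
    (\<exists>X\<subseteq>V. X \<noteq> {} \<and> card X \<le> L \<and> connected_in E X \<and> card X + m \<le> card (induced E X) + 1)"

lemma attached_witnesses_exist:
  assumes "finite V" "E \<subseteq> all_edges V" "T \<subseteq> V" and spanning: "F \<in> spanning_trees T" "F \<subseteq> E"
    and layers: "survival_layers k V E (Suc t) S"
    and I: "I \<subseteq> T" "I \<subseteq> S (Suc t)" "\<And>v. v \<in> I \<Longrightarrow> vertex_degree F v < k"
  obtains X J where "T \<subseteq> X" "X \<subseteq> V" "connected_in E X"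
    "card X \<le> card T * (1 + complete_tree_size k (Suc t))"
    "J \<subseteq> I" "occur_disjointly {J} (hanging_witnesses k V t) (E - F)"
    "card I + 2 * card X \<le> card J + 2 * card (induced E X) + 2"
proof -
  have F: "F \<subseteq> all_edges T" "card F + 1 = card T" "connected_in F T"
    using spanning(1) by (auto simp: spanning_trees_def)
  have "finite T" "T \<noteq> {}" using finite_subset[OF \<open>T \<subseteq> V\<close> \<open>finite V\<close>] F(2) by auto
  obtain X S' where X: "T \<subseteq> X" "X \<subseteq> V" "connected_in E X"
      "card X + card I \<le> card T + card I * complete_tree_size k (Suc t)"
      "survival_layers k X E (Suc t) S'" "S' (Suc t) = I"
    using sparse_survival_layers_exist[OF \<open>finite V\<close> layers \<open>T \<subseteq> V\<close>
        connected_in_mono[OF F(3) spanning(2)] I(1,2)]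
    by blast
  have "card X \<le> card T * (1 + complete_tree_size k (Suc t))"
    using X(4) mult_right_mono[OF card_mono[OF \<open>finite T\<close> I(1)], of "complete_tree_size k (Suc t)"]
    by (simp add: algebra_simps)
  let ?E = "induced E X"
  obtain R where R: "branching_from ?E T R X"
    by (rule spanning_branching_exists[OF connected_in_induced[OF X(3)]
        finite_subset[OF X(2) \<open>finite V\<close>] X(1) \<open>T \<noteq> {}\<close>])
  interpret extended_spanning_tree V X T ?E F R
  proof
    show "?E \<subseteq> all_edges X" using assms(2) by (auto simp: induced_def all_edges_def)
    show "F \<subseteq> ?E" using F(1) spanning(2) X(1) by (auto simp: induced_def all_edges_def)
  qed (fact assms X R)+
  have "survival_layers k V ?E (Suc t) S'"
    by (rule survival_layers_mono[OF survival_layers_induced[OF X(5)] X(2)])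
  then obtain J where J: "J \<subseteq> I" "card I \<le> card J + 2 * card surplus"
      "occur_disjointly {J} (hanging_witnesses k V t) (?E - F)"
    by (rule disjoint_hanging_witnesses_exist[of k t S' I]) (use X(6) I in auto)
  have "card I + 2 * card X \<le> card J + 2 * card ?E + 2"
    using J(2) card_surplus by linarith
  moreover have "occur_disjointly {J} (hanging_witnesses k V t) (E - F)"
    using J(3) by (rule occur_disjointly_mono) (auto simp: induced_def)
  ultimately show ?thesis
    using that X(1-3) J(1) \<open>card X \<le> card T * (1 + complete_tree_size k (Suc t))\<close> by blast
qed

lemma has_decorated_treeI:
  assumes "finite V" "E \<subseteq> all_edges V" "3 \<le> k"
    and no_excess: "\<not> has_excess_subgraph V (card T * (1 + complete_tree_size k (Suc t))) m E"
    and "T \<subseteq> V" and spanning: "F \<in> spanning_trees T" "F \<subseteq> E"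
    and layers: "survival_layers k V E (Suc t) S" "T \<subseteq> S (Suc t)"
  shows "has_decorated_tree k V t (card T) m E"
proof -
  have F: "F \<subseteq> all_edges T" "card F < card T"
    using spanning(1) by (auto simp: spanning_trees_def)
  define I where "I = {v \<in> T. vertex_degree F v \<le> 2}"
  have "I \<subseteq> T" "I \<subseteq> S (Suc t)"
    using layers(2) by (auto simp: I_def)
  moreover have "vertex_degree F v < k" if "v \<in> I" for v
    using \<open>3 \<le> k\<close> that by (simp add: I_def)
  ultimately obtain X J where X: "T \<subseteq> X" "X \<subseteq> V" "connected_in E X"
      "card X \<le> card T * (1 + complete_tree_size k (Suc t))"
    and J: "J \<subseteq> I" "occur_disjointly {J} (hanging_witnesses k V t) (E - F)"
      "card I + 2 * card X \<le> card J + 2 * card (induced E X) + 2"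
    using attached_witnesses_exist[OF assms(1,2) \<open>T \<subseteq> V\<close> spanning layers(1), of I] by blast
  have "X \<noteq> {}" using X(1) F(2) by auto
  then have "\<not> card X + m \<le> card (induced E X) + 1"
    using no_excess X(2-4) unfolding has_excess_subgraph_def by blast
  then have "card I \<le> card J + 2 * m" using J(3) by linarith
  moreover have "card T \<le> 3 * card I"
    unfolding I_def by (rule card_low_degree_vertices[OF finite_subset[OF \<open>T \<subseteq> V\<close> \<open>finite V\<close>] F])
  ultimately have "card T \<le> 3 * (card J + 2 * m)"
    by (meson mult_le_mono2 order_trans)
  moreover have "J \<subseteq> T" using J(1) by (auto simp: I_def)
  ultimately show ?thesis
    unfolding has_decorated_tree_def mem_Collect_eq using \<open>T \<subseteq> V\<close> spanning J(2) by blast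
qed

theorem card_graph_component_less:
  assumes "finite V" "E \<subseteq> all_edges V" "3 \<le> k" "2 \<le> s"
    and no_excess: "\<not> has_excess_subgraph V (s * (1 + complete_tree_size k (Suc t))) m E"
    and no_tree: "\<not> has_decorated_tree k V t s m E"
    and component: "C \<in> graph_components V (peel k E (Suc t))"
  shows "card C < s"
proof (rule ccontr)
  assume "\<not> card C < s"
  let ?P = "\<lambda>i. peel k E i"
  have "?P (Suc t) \<subseteq> all_edges V"
    using peel_subset assms(2) by (rule order_trans)
  then have "C \<subseteq> V" by (rule graph_component_subset[OF component])
  have "1 \<le> s" "s \<le> card C" using assms(4) \<open>\<not> card C < s\<close> by auto
  with connected_in_graph_component[OF component] finite_subset[OF \<open>C \<subseteq> V\<close> \<open>finite V\<close>]
  obtain T F where T: "T \<subseteq> C" "card T = s" "F \<in> spanning_trees T" "F \<subseteq> ?P (Suc t)"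
    by (rule subtree_exists)
  have "has_decorated_tree k V t (card T) m E"
  proof (rule has_decorated_treeI)
    show "survival_layers k V E (Suc t) (\<lambda>i. \<Union>(?P i))"
      using assms(1,2) by (rule survival_layers_peel)
    show "T \<subseteq> V" using T(1) \<open>C \<subseteq> V\<close> by (rule order_trans)
    show "F \<subseteq> E" using T(4) peel_subset by (rule order_trans)
    have "C \<subseteq> \<Union>(?P (Suc t))"
      using assms(4) component \<open>s \<le> card C\<close> by (intro nontrivial_graph_component_subset) auto
    with T(1) show "T \<subseteq> \<Union>(?P (Suc t))" by (rule order_trans)
  qed (use assms T in auto)
  then show False using no_tree T(2) by simp
qed

section \<open>First moment bounds\<close>

lemma prob_Bex_le:
  assumes "finite I" "real (card I) \<le> a" "\<And>i. i \<in> I \<Longrightarrow> prob M {x. P i x} \<le> b" "0 \<le> b"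
  shows "prob M {x. \<exists>i\<in>I. P i x} \<le> a * b"
proof -
  have "{x. \<exists>i\<in>I. P i x} = (\<Union>i\<in>I. {x. P i x})" by blast
  then have "prob M {x. \<exists>i\<in>I. P i x} \<le> (\<Sum>i\<in>I. prob M {x. P i x})"
    using measure_pmf.finite_measure_subadditive_finite[OF assms(1), of "\<lambda>i. {x. P i x}" M] by simp
  also have "\<dots> \<le> real (card I) * b" using assms(3) by (intro sum_bounded_above)
  also have "\<dots> \<le> a * b" using assms(2,4) by (rule mult_right_mono)
  finally show ?thesis .
qed

lemma binomial_le_power: "n choose r \<le> n ^ r"
  by (cases "r \<le> n") (auto simp: binomial_le_pow binomial_eq_0)

lemma choose_mult_power_le: "real (n choose s) * real s ^ s \<le> (exp 1 * real n) ^ s"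
proof -
  have "real s ^ s / fact s \<le> (\<Sum>i. real s ^ i / fact i)"
    using summable_exp[of "real s"]
    by (intro sum_le_suminf[of _ "{s}", simplified]) (simp_all add: field_simps)
  also have "\<dots> = exp (real s)"
    by (simp add: exp_def divide_inverse mult.commute)
  also have "\<dots> = exp 1 ^ s"
    by (simp flip: exp_of_nat_mult)
  finally have "real (n choose s) * real s ^ s \<le> real (n choose s) * (exp 1 ^ s * fact s)"
    by (intro mult_left_mono) (simp_all add: divide_le_eq)
  also have "\<dots> = exp 1 ^ s * real ((n choose s) * fact s)"
    by simp
  also have "\<dots> \<le> exp 1 ^ s * real (n ^ s)"
    by (intro mult_left_mono of_nat_mono binomial_fact_pow) simp
  finally show ?thesis by (simp add: power_mult_distrib)
qed

primrec survival_bound :: "nat \<Rightarrow> nat \<Rightarrow> real \<Rightarrow> nat \<Rightarrow> real" where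
  "survival_bound k n p 0 = 1"
| "survival_bound k n p (Suc t) = prob (binomial_pmf n (p * survival_bound k n p t)) {k - 1..}"

lemma survival_bound_nonneg: "0 \<le> survival_bound k n p t"
  and survival_bound_le_1: "survival_bound k n p t \<le> 1"
  by (cases t; simp)+

lemma occurrence_prob_tree_witnesses_le:
  assumes "finite A" "finite V" "0 \<le> p" "p \<le> 1"
  shows "occurrence_prob A (\<lambda>_. p) (tree_witnesses k V t v) \<le> survival_bound k (card V) p t"
proof (induction t arbitrary: v)
  case (Suc t)
  let ?\<J> = "{N. N \<subseteq> V \<and> k - 1 \<le> card N}"
  let ?\<W> = "\<lambda>w. pendant {v, w} (tree_witnesses k V t w)"
  have "occur_disjointly ?\<J> ?\<W> E" if "occurs (tree_witnesses k V (Suc t) v) E" for E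
  proof -
    from that obtain f N where "N \<subseteq> V" "card N = k - 1" "\<forall>w\<in>N. f w \<in> ?\<W> w" "disjoint_family_on f N"
        "\<Union>(f ` N) \<subseteq> E"
      by (auto simp: occurs_def)
    then show ?thesis
      unfolding occur_disjointly_def by (intro bexI[of _ N] exI[of _ f]) auto
  qed
  then have "occurrence_prob A (\<lambda>_. p) (tree_witnesses k V (Suc t) v) \<le>
      prob (random_subset A (\<lambda>_. p)) {E. occur_disjointly ?\<J> ?\<W> E}"
    unfolding occurrence_prob_def by (intro measure_pmf.finite_measure_mono) auto
  also have "\<dots> \<le> prob (binomial_pmf (card V) (p * survival_bound k (card V) p t)) {k - 1..}"
  proof (rule prob_occur_disjointly_card_le_binomial)
    show "occurrence_prob A (\<lambda>_. p) (?\<W> w) \<le> p * survival_bound k (card V) p t" for w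
      using assms Suc.IH by (intro occurrence_prob_pendant_le)
  qed (use assms survival_bound_nonneg survival_bound_le_1 in \<open>auto intro: mult_le_one\<close>)
  finally show ?case by simp
qed simp

lemma occurrence_prob_hanging_witnesses_le:
  assumes "finite A" "finite V" "0 \<le> p" "p \<le> 1"
  shows "occurrence_prob A (\<lambda>_. p) (hanging_witnesses k V t v) \<le>
    real (card V) * (p * survival_bound k (card V) p t)"
proof -
  let ?\<W> = "\<lambda>w. pendant {v, w} (tree_witnesses k V t w)"
  have "occurrence_prob A (\<lambda>_. p) (?\<W> w) \<le> p * survival_bound k (card V) p t" for w
    using assms by (intro occurrence_prob_pendant_le occurrence_prob_tree_witnesses_le)
  then have "prob (random_subset A (\<lambda>_. p)) {E. \<exists>w\<in>V. occurs (?\<W> w) E} \<le>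
      real (card V) * (p * survival_bound k (card V) p t)"
    using assms survival_bound_nonneg by (intro prob_Bex_le) (auto simp: occurrence_prob_def)
  moreover have "{E. occurs (hanging_witnesses k V t v) E} = {E. \<exists>w\<in>V. occurs (?\<W> w) E}"
    by (auto simp: occurs_def hanging_witnesses_def)
  ultimately show ?thesis by (simp add: occurrence_prob_def)
qed

lemma prob_decorated_tree_le:
  assumes "finite A" "finite V" "0 \<le> p" "p \<le> 1" "finite J"
    and b: "real (card V) * (p * survival_bound k (card V) p t) \<le> b"
  shows "prob (random_subset A (\<lambda>_. p))
      {E. F \<subseteq> E \<and> occur_disjointly {J} (hanging_witnesses k V t) (E - F)} \<le> p ^ card F * b ^ card J"
proof -
  have "prob (random_subset A (\<lambda>_. p))
        {E. F \<subseteq> E \<and> occur_disjointly {J} (hanging_witnesses k V t) (E - F)} \<le>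
      (\<Prod>e\<in>F. p) * (\<Prod>j\<in>J. occurrence_prob A (\<lambda>_. p) (hanging_witnesses k V t j))"
    using assms by (intro prob_superset_and_occur_disjointly_le)
  also have "\<dots> \<le> (\<Prod>e\<in>F. p) * (\<Prod>j\<in>J. b)"
    using assms(3) order_trans[OF occurrence_prob_hanging_witnesses_le[OF assms(1-4)] b]
    by (intro mult_left_mono prod_mono prod_nonneg) auto
  finally show ?thesis by simp
qed

lemma prob_has_decorated_tree_le:
  assumes "finite V" "0 \<le> p" "p \<le> 1" and \<eta>: "0 < \<eta>" "\<eta> \<le> 1"
    and "real (card V) * (p * survival_bound k (card V) p t) \<le> \<eta> ^ 3"
  shows "prob (random_subset (all_edges V) (\<lambda>_. p)) {E. has_decorated_tree k V t s m E} \<le>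
    (exp 1 * real (card V)) ^ s * (2 ^ s * (p ^ (s - 1) * (\<eta> ^ s / \<eta> ^ (6 * m))))"
proof -
  let ?M = "random_subset (all_edges V) (\<lambda>_. p)"
  let ?b = "p ^ (s - 1) * (\<eta> ^ s / \<eta> ^ (6 * m))"
  have "prob ?M {E. has_decorated_tree k V t s m E} \<le>
      real (card V choose s) * (real s ^ s * (2 ^ s * ?b))"
    unfolding has_decorated_tree_def
  proof (intro prob_Bex_le)
    fix T assume T: "T \<in> {T. T \<subseteq> V \<and> card T = s}"
    then have "finite T" using \<open>finite V\<close> finite_subset by blast
    show "finite (spanning_trees T)" "real (card (spanning_trees T)) \<le> real s ^ s"
      using card_spanning_trees[OF \<open>finite T\<close>] T by (auto simp flip: of_nat_power)
    let ?\<J> = "{J. J \<subseteq> T \<and> s \<le> 3 * (card J + 2 * m)}"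
    show "finite ?\<J>" using \<open>finite T\<close> by simp
    have "card ?\<J> \<le> card (Pow T)" using \<open>finite T\<close> by (intro card_mono) auto
    then show "real (card ?\<J>) \<le> 2 ^ s"
      using \<open>finite T\<close> T by (simp add: card_Pow flip: of_nat_power)
    fix F J assume F: "F \<in> spanning_trees T" and J: "J \<in> ?\<J>"
    have "card F = s - 1" using F T by (auto simp: spanning_trees_def)
    moreover have "finite J" using J \<open>finite T\<close> finite_subset by blast
    ultimately have "prob ?M {E. F \<subseteq> E \<and> occur_disjointly {J} (hanging_witnesses k V t) (E - F)} \<le>
        p ^ (s - 1) * (\<eta> ^ 3) ^ card J"
      using prob_decorated_tree_le[of "all_edges V" V p J k t "\<eta> ^ 3" F] assms by simp
    also have "(\<eta> ^ 3) ^ card J \<le> \<eta> ^ s / \<eta> ^ (6 * m)"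
    proof -
      have "(\<eta> ^ 3) ^ card J * \<eta> ^ (6 * m) = \<eta> ^ (3 * (card J + 2 * m))"
        by (simp flip: power_mult power_add)
      also have "\<dots> \<le> \<eta> ^ s"
        using J \<eta> by (intro power_decreasing) auto
      finally show ?thesis
        using \<eta>(1) by (simp add: pos_le_divide_eq)
    qed
    finally show "prob ?M {E. F \<subseteq> E \<and> occur_disjointly {J} (hanging_witnesses k V t) (E - F)} \<le> ?b"
      using assms(2) by (simp add: mult_left_mono)
  qed (use assms in \<open>auto simp: n_subsets\<close>)
  also have "\<dots> = real (card V choose s) * real s ^ s * (2 ^ s * ?b)"
    by simp
  also have "\<dots> \<le> (exp 1 * real (card V)) ^ s * (2 ^ s * ?b)"
    using assms(2,3) \<eta>(1) by (intro mult_right_mono choose_mult_power_le) auto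
  finally show ?thesis .
qed

definition contains_tree_with_surplus :: "'a set \<Rightarrow> nat \<Rightarrow> 'a set set \<Rightarrow> bool" where
  "contains_tree_with_surplus X m E \<longleftrightarrow>
    (\<exists>F\<in>spanning_trees X. \<exists>D\<in>{D. D \<subseteq> all_edges X - F \<and> card D = m}. F \<union> D \<subseteq> E)"

lemma has_excess_subgraph_imp_tree_with_surplus:
  assumes "has_excess_subgraph V L m E" "finite V" "E \<subseteq> all_edges V"
  shows "\<exists>l\<in>{1..L}. \<exists>X\<in>{X. X \<subseteq> V \<and> card X = l}. contains_tree_with_surplus X m E"
proof -
  obtain X where X: "X \<subseteq> V" "X \<noteq> {}" "card X \<le> L" "connected_in E X"
      "card X + m \<le> card (induced E X) + 1"
    using assms(1) by (auto simp: has_excess_subgraph_def)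
  have "finite X" using finite_subset[OF X(1) assms(2)] .
  then have "1 \<le> card X" using X(2) by (simp add: Suc_le_eq card_gt_0_iff)
  obtain F where F: "F \<in> spanning_trees X" "F \<subseteq> E"
    by (rule spanning_tree_exists[OF X(4) \<open>finite X\<close> X(2)])
  then have "F \<subseteq> induced E X" "card F + 1 = card X"
    by (auto simp: induced_def spanning_trees_def all_edges_def)
  moreover have "finite (induced E X)"
    using finite_subset[OF assms(3) finite_all_edges[OF assms(2)]] by (simp add: induced_def)
  ultimately have "m \<le> card (induced E X - F)"
    using X(5) by (simp add: card_Diff_subset finite_subset)
  then obtain D where D: "D \<subseteq> induced E X - F" "card D = m"
    by (meson obtain_subset_with_card_n)
  then have "D \<subseteq> all_edges X - F" "F \<union> D \<subseteq> E"
    using assms(3) F(2) by (auto simp: induced_def all_edges_def)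
  then have "contains_tree_with_surplus X m E"
    unfolding contains_tree_with_surplus_def using F(1) D(2) by blast
  then show ?thesis
    using X(1,3) \<open>1 \<le> card X\<close> by (intro bexI[of _ "card X"] bexI[of _ X]) auto
qed

lemma prob_contains_tree_with_surplus_le:
  assumes "finite A" "finite X" "0 \<le> p" "p \<le> 1"
  shows "prob (random_subset A (\<lambda>_. p)) {E. contains_tree_with_surplus X m E} \<le>
    real (card X) ^ card X * ((real (card X) ^ 2) ^ m * p ^ (card X - 1 + m))"
  unfolding contains_tree_with_surplus_def
proof (intro prob_Bex_le)
  fix F assume F: "F \<in> spanning_trees X"
  let ?\<D> = "{D. D \<subseteq> all_edges X - F \<and> card D = m}"
  show "finite ?\<D>" using assms(2) by simp
  have "card ?\<D> = card (all_edges X - F) choose m"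
    using assms(2) by (intro n_subsets) simp
  also have "\<dots> \<le> card (all_edges X - F) ^ m"
    by (rule binomial_le_power)
  also have "card (all_edges X - F) \<le> card X ^ 2"
  proof -
    have "card (all_edges X - F) \<le> card (all_edges X)"
      using assms(2) by (intro card_mono) auto
    then show ?thesis
      using binomial_le_power[of "card X" 2] card_all_edges[OF assms(2)] by simp
  qed
  finally show "real (card ?\<D>) \<le> (real (card X) ^ 2) ^ m"
    by (simp add: power_mono flip: of_nat_power)
  fix D assume D: "D \<in> ?\<D>"
  have "finite (all_edges X)" using assms(2) by simp
  then have "card (F \<union> D) = card X - 1 + m"
    using F D by (subst card_Un_disjoint) (auto simp: spanning_trees_def intro: finite_subset)
  then show "prob (random_subset A (\<lambda>_. p)) {E. F \<union> D \<subseteq> E} \<le> p ^ (card X - 1 + m)"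
    using prob_random_subset_superset_le[OF assms(1), of "\<lambda>_. p" "F \<union> D"] assms(3,4) by simp
qed (use assms card_spanning_trees[OF assms(2)] in \<open>auto simp flip: of_nat_power\<close>)

lemma prob_ex_tree_with_surplus_le:
  assumes "finite A" "finite V" "V \<noteq> {}" and p: "0 \<le> p" "p \<le> 1"
    and b: "real (card V) * p \<le> b" "1 \<le> b" and l: "l \<in> {1..L}"
  shows "prob (random_subset A (\<lambda>_. p))
      {E. \<exists>X\<in>{X. X \<subseteq> V \<and> card X = l}. contains_tree_with_surplus X m E} \<le>
    (exp 1 * b) ^ L * (b * real L ^ 2) ^ m * (real (card V) / real (card V) ^ m)"
proof -
  let ?n = "real (card V)"
  have "0 < ?n" using assms(2,3) by (simp add: card_gt_0_iff)
  have "prob (random_subset A (\<lambda>_. p))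
        {E. \<exists>X\<in>{X. X \<subseteq> V \<and> card X = l}. contains_tree_with_surplus X m E} \<le>
      real (card V choose l) * (real l ^ l * ((real l ^ 2) ^ m * p ^ (l - 1 + m)))"
  proof (rule prob_Bex_le)
    fix X assume X: "X \<in> {X. X \<subseteq> V \<and> card X = l}"
    then have "finite X" using assms(2) finite_subset by blast
    show "prob (random_subset A (\<lambda>_. p)) {E. contains_tree_with_surplus X m E} \<le>
        real l ^ l * ((real l ^ 2) ^ m * p ^ (l - 1 + m))"
      using prob_contains_tree_with_surplus_le[OF assms(1) \<open>finite X\<close> p, of m] X by simp
  qed (use assms in \<open>auto simp: n_subsets\<close>)
  also have "\<dots> \<le> (exp 1 * ?n) ^ l * ((real L ^ 2) ^ m * p ^ (l - 1 + m))"
    unfolding mult.assoc[symmetric] using p(1) l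
    by (intro mult_mono choose_mult_power_le power_mono) auto
  also have "\<dots> = exp 1 ^ l * (?n * p) ^ (l - 1 + m) * (real L ^ 2) ^ m * (?n / ?n ^ m)"
  proof -
    obtain l' where "l = Suc l'" using l by (cases l) auto
    then show ?thesis using \<open>0 < ?n\<close> by (simp add: power_mult_distrib power_add field_simps)
  qed
  also have "\<dots> \<le> exp 1 ^ L * b ^ (L + m) * (real L ^ 2) ^ m * (?n / ?n ^ m)"
  proof -
    have "(?n * p) ^ (l - 1 + m) \<le> b ^ (l - 1 + m)"
      using p(1) b(1) by (intro power_mono) auto
    also have "\<dots> \<le> b ^ (L + m)"
      using b(2) l by (intro power_increasing) auto
    finally have "(?n * p) ^ (l - 1 + m) \<le> b ^ (L + m)" .
    moreover have "exp 1 ^ l \<le> (exp 1 :: real) ^ L"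
      using l by (intro power_increasing) auto
    ultimately show ?thesis
      using p(1) b(2) by (intro mult_right_mono mult_mono) auto
  qed
  also have "\<dots> = (exp 1 * b) ^ L * (b * real L ^ 2) ^ m * (?n / ?n ^ m)"
    by (simp add: power_mult_distrib power_add mult_ac)
  finally show ?thesis .
qed

lemma prob_has_excess_subgraph_le:
  assumes "finite V" "V \<noteq> {}" "0 \<le> p" "p \<le> 1" "real (card V) * p \<le> b" "1 \<le> b"
  shows "prob (random_subset (all_edges V) (\<lambda>_. p)) {E. has_excess_subgraph V L m E} \<le>
    real L * ((exp 1 * b) ^ L * (b * real L ^ 2) ^ m * (real (card V) / real (card V) ^ m))"
proof -
  let ?M = "random_subset (all_edges V) (\<lambda>_. p)"
  let ?b = "(exp 1 * b) ^ L * (b * real L ^ 2) ^ m * (real (card V) / real (card V) ^ m)"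
  let ?Q = "\<lambda>E. \<exists>l\<in>{1..L}. \<exists>X\<in>{X. X \<subseteq> V \<and> card X = l}. contains_tree_with_surplus X m E"
  have "prob ?M {E. has_excess_subgraph V L m E} =
      prob ?M ({E. has_excess_subgraph V L m E} \<inter> set_pmf ?M)"
    by (simp add: measure_Int_set_pmf)
  also have "\<dots> \<le> prob ?M {E. ?Q E}"
  proof (intro measure_pmf.finite_measure_mono subsetI CollectI)
    fix E assume E: "E \<in> {E. has_excess_subgraph V L m E} \<inter> set_pmf ?M"
    then have "E \<subseteq> all_edges V" using set_pmf_random_subset by blast
    with E assms(1) show "?Q E"
      by (intro has_excess_subgraph_imp_tree_with_surplus) auto
  qed simp
  also have "\<dots> \<le> real L * ?b"
  proof (rule prob_Bex_le)
    fix l assume "l \<in> {1..L}"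
    then show "prob ?M {E. \<exists>X\<in>{X. X \<subseteq> V \<and> card X = l}. contains_tree_with_surplus X m E} \<le> ?b"
      using assms by (intro prob_ex_tree_with_surplus_le) auto
  qed (use assms(6) in auto)
  finally show ?thesis .
qed

section \<open>The limiting recursion\<close>

definition poisson_tail :: "nat \<Rightarrow> real \<Rightarrow> real" where
  "poisson_tail m r = 1 - (\<Sum>i<m. r ^ i / fact i) * exp (- r)"

lemma prob_atLeast_eq_sum: "prob M {m..} = 1 - (\<Sum>i<m. pmf M i)" for m :: nat
proof -
  have "{m..} = UNIV - {..<m}" by auto
  then have "prob M {m..} = 1 - prob M {..<m}"
    using measure_pmf.prob_compl[of "{..<m}" M] by simp
  then show ?thesis by (simp add: measure_measure_pmf_finite)
qed

lemma prob_poisson0_tail: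
  assumes "0 \<le> r" "0 < m"
  shows "prob (poisson0_pmf r) {m..} = poisson_tail m r"
proof -
  have "pmf (poisson0_pmf r) i = r ^ i / fact i * exp (- r)" for i
    using assms(1) by (auto simp: poisson0_pmf_def power_0_left indicator_def)
  then show ?thesis
    by (simp add: prob_atLeast_eq_sum poisson_tail_def sum_distrib_right)
qed

lemma poisson_tail_nonneg: "0 \<le> r \<Longrightarrow> 0 < m \<Longrightarrow> 0 \<le> poisson_tail m r"
  by (simp flip: prob_poisson0_tail)

lemma poisson_tail_0: "0 < m \<Longrightarrow> poisson_tail m 0 = 0"
  by (simp add: poisson_tail_def power_0_left if_distrib[of "\<lambda>x. x / _"] cong: if_cong)

lemma poisson_tail_less_1:
  assumes "0 \<le> r" "0 < m"
  shows "poisson_tail m r < 1"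
proof -
  have "0 < (\<Sum>i<m. r ^ i / fact i)"
    using assms by (intro sum_pos2[of _ 0]) auto
  then show ?thesis by (simp add: poisson_tail_def)
qed

lemma continuous_on_poisson_tail [continuous_intros]:
  "continuous_on A f \<Longrightarrow> continuous_on A (\<lambda>x. poisson_tail m (f x))"
  unfolding poisson_tail_def by (intro continuous_intros) auto

lemma fixed_point_le_core_beta:
  assumes "2 \<le> k" "0 \<le> c" "x \<in> {0..1}" "poisson_tail (k - 1) (c * x) = x"
  shows "x \<le> core_beta k c"
proof -
  define fixed where "fixed = {x \<in> {0..1}. poisson_tail (k - 1) (c * x) - x = 0}"
  have fixed_iff: "y \<in> {0..1} \<and> y = prob (poisson0_pmf (c * y)) {j. k - 1 \<le> j} \<longleftrightarrow> y \<in> fixed" for y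
    using assms(1,2) by (auto simp: fixed_def prob_poisson0_tail[unfolded atLeast_def])
  have "bounded fixed"
    by (rule bounded_subset[OF bounded_closed_interval[of 0 1]]) (auto simp: fixed_def)
  moreover have "closed fixed"
    unfolding fixed_def by (intro continuous_closed_preimage_constant continuous_intros)
  ultimately have "compact fixed"
    by (simp add: compact_eq_bounded_closed)
  moreover have "x \<in> fixed" using assms(3,4) by (simp add: fixed_def)
  ultimately obtain y where y: "y \<in> fixed" "\<And>z. z \<in> fixed \<Longrightarrow> z \<le> y"
    using compact_attains_sup[of fixed] by blast
  have "core_beta k c = y"
    unfolding core_beta_def fixed_iff using y by (intro Greatest_equality) auto
  then show ?thesis using y(2) \<open>x \<in> fixed\<close> by simp
qed

lemma core_threshold_le:
  assumes "2 \<le> k" "0 < c" "0 < x" "x \<le> 1" "poisson_tail (k - 1) (c * x) = x"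
  shows "core_threshold k \<le> c"
proof -
  have "0 < core_beta k c"
    using fixed_point_le_core_beta[of k c x] assms by simp
  moreover have "bdd_below {c. 0 < c \<and> 0 < core_beta k c}"
    by (rule bdd_belowI[of _ 0]) auto
  ultimately show ?thesis
    unfolding core_threshold_def using assms(2) by (intro cInf_lower) auto
qed

lemma poisson_tail_less_below_threshold:
  assumes "2 \<le> k" "0 < c" "c < core_threshold k" "0 < x" "x \<le> 1"
  shows "poisson_tail (k - 1) (c * x) < x"
proof (rule ccontr)
  assume "\<not> ?thesis"
  then have "0 \<le> poisson_tail (k - 1) (c * x) - x" by simp
  moreover have "poisson_tail (k - 1) (c * 1) - 1 \<le> 0"
    using poisson_tail_less_1[of "c * 1" "k - 1"] assms(1,2) by simp
  ultimately have "\<exists>y\<ge>x. y \<le> 1 \<and> poisson_tail (k - 1) (c * y) - y = 0"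
    by (intro IVT2' assms(5) continuous_intros)
  then obtain y where "x \<le> y" "y \<le> 1" "poisson_tail (k - 1) (c * y) = y" by auto
  then have "core_threshold k \<le> c"
    using assms(1,2,4) by (intro core_threshold_le[of k c y]) auto
  then show False using assms(3) by simp
qed

primrec survival_limit :: "nat \<Rightarrow> real \<Rightarrow> nat \<Rightarrow> real" where
  "survival_limit k c 0 = 1"
| "survival_limit k c (Suc t) = poisson_tail (k - 1) (c * survival_limit k c t)"

lemma survival_limit_bounds:
  assumes "2 \<le> k" "0 \<le> c"
  shows "survival_limit k c t \<in> {0..1}"
proof (induction t)
  case (Suc t)
  then show ?case
    using poisson_tail_nonneg[of "c * survival_limit k c t" "k - 1"]
      poisson_tail_less_1[of "c * survival_limit k c t" "k - 1"] assms by auto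
qed simp

lemma survival_limit_tendsto_0:
  assumes "2 \<le> k" "0 < c" "c < core_threshold k"
  shows "survival_limit k c \<longlonglongrightarrow> 0"
proof -
  let ?x = "survival_limit k c"
  have bounds: "0 \<le> ?x t" "?x t \<le> 1" for t
    using survival_limit_bounds[of k c t] assms by auto
  have "?x (Suc t) \<le> ?x t" for t
  proof (cases "?x t = 0")
    case True
    then show ?thesis using assms(1) by (simp add: poisson_tail_0)
  next
    case False
    then show ?thesis
      using poisson_tail_less_below_threshold[OF assms, of "?x t"] bounds[of t] by simp
  qed
  then have "decseq ?x" by (intro decseq_SucI)
  then obtain l where l: "?x \<longlonglongrightarrow> l"
    using decseq_convergent[of ?x 0] bounds(1) by blast
  have "0 \<le> l" "l \<le> 1"
    using LIMSEQ_le_const[OF l] LIMSEQ_le_const2[OF l] bounds by blast+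
  have "isCont (\<lambda>x. poisson_tail (k - 1) (c * x)) l"
    using continuous_on_eq_continuous_at[of UNIV "\<lambda>x. poisson_tail (k - 1) (c * x)"]
    by (auto intro: continuous_intros)
  then have "(\<lambda>t. ?x (Suc t)) \<longlonglongrightarrow> poisson_tail (k - 1) (c * l)"
    using l by (auto dest: isCont_tendsto_compose)
  then have "poisson_tail (k - 1) (c * l) = l"
    using LIMSEQ_unique LIMSEQ_Suc[OF l] by blast
  then have "\<not> 0 < l"
    using poisson_tail_less_below_threshold[OF assms _ \<open>l \<le> 1\<close>] by force
  then show ?thesis using l \<open>0 \<le> l\<close> by simp
qed

lemma binomial_div_power_tendsto:
  "(\<lambda>n. real (n choose i) / real n ^ i) \<longlonglongrightarrow> 1 / fact i"
proof (induction i)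
  case (Suc i)
  have "real (n choose Suc i) / real n ^ Suc i =
      real (n choose i) / real n ^ i * ((real n - real i) / real n) / real (Suc i)" for n
  proof -
    have "real (Suc i) * real (n choose Suc i) = (real n - real i) * real (n choose i)"
      using gbinomial_mult_1[of "real n" i] by (simp add: binomial_gbinomial algebra_simps)
    then have "real (n choose Suc i) = (real n - real i) * real (n choose i) / real (Suc i)"
      by (simp add: eq_divide_eq mult.commute)
    then show ?thesis by (simp add: mult_ac)
  qed
  moreover have "(\<lambda>n. (real n - real i) / real n) \<longlonglongrightarrow> 1" by real_asymp
  then have "(\<lambda>n. real (n choose i) / real n ^ i * ((real n - real i) / real n) / real (Suc i)) \<longlonglongrightarrow>
      1 / fact i * 1 / real (Suc i)"
    by (intro tendsto_intros Suc.IH) auto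
  ultimately show ?case by (simp add: field_simps)
qed simp

lemma power_one_minus_bounds:
  assumes "0 \<le> q" "q < 1"
  shows "exp (- (real n * q / (1 - q))) \<le> (1 - q) ^ n" and "(1 - q) ^ n \<le> exp (- (real n * q))"
proof -
  have "inverse (1 - q) = 1 + q / (1 - q)"
    using assms by (simp add: field_simps)
  also have "\<dots> \<le> exp (q / (1 - q))" by (rule exp_ge_add_one_self)
  finally have "exp (- (q / (1 - q))) \<le> 1 - q"
    using assms by (simp add: exp_minus inverse_le_iff_le[symmetric] field_simps)
  then have "exp (- (q / (1 - q))) ^ n \<le> (1 - q) ^ n"
    by (intro power_mono) auto
  then show "exp (- (real n * q / (1 - q))) \<le> (1 - q) ^ n"
    by (simp flip: exp_of_nat_mult)
  have "(1 - q) ^ n \<le> exp (- q) ^ n"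
    using exp_ge_add_one_self[of "- q"] assms by (intro power_mono) auto
  then show "(1 - q) ^ n \<le> exp (- (real n * q))"
    by (simp flip: exp_of_nat_mult)
qed

lemma power_one_minus_tendsto_exp:
  assumes "(\<lambda>n. real n * q n) \<longlonglongrightarrow> r" "\<And>n. 0 \<le> q n"
  shows "q \<longlonglongrightarrow> 0" and "(\<lambda>n. (1 - q n) ^ n) \<longlonglongrightarrow> exp (- r)"
proof -
  have "(\<lambda>n. real n * q n * (1 / real n)) \<longlonglongrightarrow> r * 0"
    by (intro tendsto_mult assms) real_asymp
  moreover have "\<forall>\<^sub>F n in sequentially. real n * q n * (1 / real n) = q n"
    using eventually_gt_at_top[of 0] by eventually_elim simp
  ultimately show q: "q \<longlonglongrightarrow> 0" by (simp add: tendsto_cong)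
  have "\<forall>\<^sub>F n in sequentially. q n < 1"
    using q by (rule order_tendstoD) simp
  then have "\<forall>\<^sub>F n in sequentially. exp (- (real n * q n / (1 - q n))) \<le> (1 - q n) ^ n"
    and "\<forall>\<^sub>F n in sequentially. (1 - q n) ^ n \<le> exp (- (real n * q n))"
    by (eventually_elim, use assms(2) power_one_minus_bounds in blast)+
  moreover have "(\<lambda>n. exp (- (real n * q n / (1 - q n)))) \<longlonglongrightarrow> exp (- (r / (1 - 0)))"
    by (intro tendsto_intros assms(1) q) simp
  moreover have "(\<lambda>n. exp (- (real n * q n))) \<longlonglongrightarrow> exp (- r)"
    by (intro tendsto_intros assms(1))
  ultimately show "(\<lambda>n. (1 - q n) ^ n) \<longlonglongrightarrow> exp (- r)"
    by (auto intro: tendsto_sandwich)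
qed

lemma pmf_binomial_tendsto_poisson:
  assumes "(\<lambda>n. real n * q n) \<longlonglongrightarrow> r" "\<And>n. 0 \<le> q n"
  shows "(\<lambda>n. pmf (binomial_pmf n (q n)) i) \<longlonglongrightarrow> r ^ i / fact i * exp (- r)"
proof -
  note lim = power_one_minus_tendsto_exp[OF assms]
  have "(\<lambda>n. real (n choose i) / real n ^ i * (real n * q n) ^ i *
        ((1 - q n) ^ n / (1 - q n) ^ i)) \<longlonglongrightarrow>
      1 / fact i * r ^ i * (exp (- r) / (1 - 0) ^ i)"
    by (intro tendsto_intros binomial_div_power_tendsto lim assms(1)) auto
  moreover have "\<forall>\<^sub>F n in sequentially. real (n choose i) / real n ^ i * (real n * q n) ^ i *
      ((1 - q n) ^ n / (1 - q n) ^ i) = pmf (binomial_pmf n (q n)) i"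
    using order_tendstoD(2)[OF lim(1) zero_less_one] eventually_gt_at_top[of i]
  proof eventually_elim
    case (elim n)
    then have "(1 - q n) ^ (n - i) = (1 - q n) ^ n / (1 - q n) ^ i"
      by (intro power_diff) auto
    then show ?case
      using elim assms(2)[of n] by (simp add: power_mult_distrib)
  qed
  ultimately show ?thesis by (simp add: tendsto_cong)
qed

lemma binomial_tail_tendsto_poisson_tail:
  assumes "(\<lambda>n. real n * q n) \<longlonglongrightarrow> r" "\<And>n. 0 \<le> q n"
  shows "(\<lambda>n. prob (binomial_pmf n (q n)) {m..}) \<longlonglongrightarrow> poisson_tail m r"
  unfolding prob_atLeast_eq_sum poisson_tail_def sum_distrib_right
  by (intro tendsto_intros pmf_binomial_tendsto_poisson assms)

lemma survival_bound_tendsto: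
  assumes "0 \<le> c"
  shows "(\<lambda>n. survival_bound k n (c / real n) t) \<longlonglongrightarrow> survival_limit k c t"
proof (induction t)
  case (Suc t)
  let ?q = "\<lambda>n. c / real n * survival_bound k n (c / real n) t"
  have "(\<lambda>n. c * survival_bound k n (c / real n) t) \<longlonglongrightarrow> c * survival_limit k c t"
    by (intro tendsto_intros Suc.IH)
  moreover have "\<forall>\<^sub>F n in sequentially. c * survival_bound k n (c / real n) t = real n * ?q n"
    using eventually_gt_at_top[of 0] by eventually_elim simp
  ultimately have "(\<lambda>n. real n * ?q n) \<longlonglongrightarrow> c * survival_limit k c t"
    by (rule Lim_transform_eventually)
  moreover have "0 \<le> ?q n" for n
    using assms survival_bound_nonneg by (intro mult_nonneg_nonneg) auto
  ultimately show ?case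
    unfolding survival_bound.simps survival_limit.simps by (rule binomial_tail_tendsto_poisson_tail)
qed simp

section \<open>Small components with high probability\<close>

definition whp :: "(nat \<Rightarrow> 'a pmf) \<Rightarrow> (nat \<Rightarrow> 'a \<Rightarrow> bool) \<Rightarrow> bool" where
  "whp M P \<longleftrightarrow> (\<lambda>n. prob (M n) {x. P n x}) \<longlonglongrightarrow> 1"

lemma whp_iff_complement: "whp M P \<longleftrightarrow> (\<lambda>n. prob (M n) {x. \<not> P n x}) \<longlonglongrightarrow> 0"
proof -
  have "prob (M n) {x. \<not> P n x} = 1 - prob (M n) {x. P n x}" for n
    using measure_pmf.prob_compl[of "{x. P n x}" "M n"] by (simp add: set_diff_eq)
  then show ?thesis
    using tendsto_diff[OF tendsto_const, of "\<lambda>n. prob (M n) {x. P n x}" 1 sequentially 1]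
      tendsto_diff[OF tendsto_const, of "\<lambda>n. 1 - prob (M n) {x. P n x}" 0 sequentially 1]
    by (auto simp: whp_def)
qed

lemma whp_notI: "(\<lambda>n. prob (M n) {x. P n x}) \<longlonglongrightarrow> 0 \<Longrightarrow> whp M (\<lambda>n x. \<not> P n x)"
  by (simp add: whp_iff_complement)

lemma whp_conj:
  assumes "whp M P" "whp M Q"
  shows "whp M (\<lambda>n x. P n x \<and> Q n x)"
  unfolding whp_iff_complement
proof (rule tendsto_sandwich[of "\<lambda>_. 0"])
  show "\<forall>\<^sub>F n in sequentially. prob (M n) {x. \<not> (P n x \<and> Q n x)} \<le>
      prob (M n) {x. \<not> P n x} + prob (M n) {x. \<not> Q n x}"
  proof (intro always_eventually allI)
    fix n
    have "{x. \<not> (P n x \<and> Q n x)} = {x. \<not> P n x} \<union> {x. \<not> Q n x}" by blast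
    then show "prob (M n) {x. \<not> (P n x \<and> Q n x)} \<le>
        prob (M n) {x. \<not> P n x} + prob (M n) {x. \<not> Q n x}"
      by (simp add: measure_Un_le)
  qed
  show "(\<lambda>n. prob (M n) {x. \<not> P n x} + prob (M n) {x. \<not> Q n x}) \<longlonglongrightarrow> 0"
    using tendsto_add[OF assms[unfolded whp_iff_complement]] by simp
qed auto

lemma whp_mono:
  assumes "whp M P" "\<forall>\<^sub>F n in sequentially. \<forall>x\<in>set_pmf (M n). P n x \<longrightarrow> Q n x"
  shows "whp M Q"
  unfolding whp_def
proof (rule tendsto_sandwich)
  show "\<forall>\<^sub>F n in sequentially. prob (M n) {x. P n x} \<le> prob (M n) {x. Q n x}"
    using assms(2)
  proof eventually_elim
    case (elim n)
    have "prob (M n) ({x. P n x} \<inter> set_pmf (M n)) \<le> prob (M n) {x. Q n x}"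
      using elim by (intro measure_pmf.finite_measure_mono) auto
    then show ?case by (simp add: measure_Int_set_pmf)
  qed
  show "(\<lambda>n. prob (M n) {x. P n x}) \<longlonglongrightarrow> 1"
    using assms(1) by (simp add: whp_def)
qed auto

lemma gnp_eq_random_subset: "gnp n p = random_subset (all_edges {..<n}) (\<lambda>_. p)"
  by (simp add: gnp_def random_subset_def)

lemma decorated_tree_bound_le:
  fixes n :: real
  assumes "0 < n" and c: "0 < c" "c \<le> b" and "1 \<le> b" and \<eta>: "\<eta> = exp (- 3) / (2 * b)"
    and "0 < s" "0 < d"
  shows "(exp 1 * n) ^ s * (2 ^ s * ((c / n) ^ (s - 1) * (\<eta> ^ s / d))) \<le> n * exp (- 2 * real s) / d"
proof -
  obtain s' where s: "s = Suc s'" using \<open>0 < s\<close> by (cases s) auto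
  have "\<eta> > 0" using \<open>1 \<le> b\<close> \<eta> by simp
  have "b * (2 * exp 1 * \<eta>) = exp (1 + - 3)"
    unfolding exp_add using \<open>1 \<le> b\<close> \<eta> by simp
  then have exp_s: "b ^ s * (2 * exp 1 * \<eta>) ^ s = exp (- 2 * real s)"
    by (simp add: mult.commute flip: power_mult_distrib exp_of_nat_mult)
  have "c ^ s' \<le> b ^ s'" using c by (intro power_mono) auto
  also have "\<dots> \<le> b ^ s" using \<open>1 \<le> b\<close> by (intro power_increasing) (auto simp: s)
  finally have "c ^ s' \<le> b ^ s" .
  have "(exp 1 * n) ^ s * (2 ^ s * ((c / n) ^ (s - 1) * (\<eta> ^ s / d))) =
      (n ^ s * (c / n) ^ s') * (2 * exp 1 * \<eta>) ^ s / d"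
    by (simp add: s power_mult_distrib mult_ac)
  also have "n ^ s * (c / n) ^ s' = n * c ^ s'"
    using \<open>0 < n\<close> by (simp add: s power_divide)
  also have "n * c ^ s' * (2 * exp 1 * \<eta>) ^ s / d \<le> n * b ^ s * (2 * exp 1 * \<eta>) ^ s / d"
    using \<open>0 < n\<close> \<open>0 < d\<close> \<open>c ^ s' \<le> b ^ s\<close> \<open>\<eta> > 0\<close>
    by (intro divide_right_mono mult_right_mono mult_left_mono) auto
  also have "\<dots> = n * exp (- 2 * real s) / d"
    by (simp only: mult.assoc[of n] exp_s)
  finally show ?thesis .
qed

lemma whp_no_decorated_tree:
  assumes c: "0 < c" "c \<le> b" and "1 \<le> b" and \<eta>: "\<eta> = exp (- 3) / (2 * b)"
    and survival: "\<forall>\<^sub>F n in sequentially. c * survival_bound k n (c / real n) t \<le> \<eta> ^ 3"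
    and s: "\<forall>\<^sub>F n in sequentially. 0 < s n \<and> ln (real n) \<le> real (s n)"
  shows "whp (\<lambda>n. gnp n (c / real n)) (\<lambda>n E. \<not> has_decorated_tree k {..<n} t (s n) m E)"
proof (rule whp_notI, rule tendsto_sandwich[of "\<lambda>_. 0"])
  have "exp (- 3) \<le> 2 * b"
    using \<open>1 \<le> b\<close> exp_le_one_iff[of "- 3 :: real"] by linarith
  then have \<eta>_bounds: "0 < \<eta>" "\<eta> \<le> 1" using \<open>1 \<le> b\<close> \<eta> by simp_all
  show "\<forall>\<^sub>F n in sequentially.
      prob (gnp n (c / real n)) {E. has_decorated_tree k {..<n} t (s n) m E} \<le>
      1 / \<eta> ^ (6 * m) * (1 / real n)"
    using survival s eventually_gt_at_top[of 0] eventually_ge_at_top[of "nat \<lceil>c\<rceil>"]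
  proof eventually_elim
    case (elim n)
    then have n: "0 < real n" "c \<le> real n" by linarith+
    have "prob (gnp n (c / real n)) {E. has_decorated_tree k {..<n} t (s n) m E} \<le>
        (exp 1 * real n) ^ s n * (2 ^ s n * ((c / real n) ^ (s n - 1) * (\<eta> ^ s n / \<eta> ^ (6 * m))))"
      unfolding gnp_eq_random_subset
      using prob_has_decorated_tree_le[of "{..<n}" "c / real n" \<eta> k t "s n" m] c(1) n \<eta>_bounds elim
      by simp
    also have "\<dots> \<le> real n * exp (- 2 * real (s n)) / \<eta> ^ (6 * m)"
      using c \<open>1 \<le> b\<close> \<eta> n \<eta>_bounds elim by (intro decorated_tree_bound_le) auto
    also have "\<dots> \<le> real n * exp (- (2 * ln (real n))) / \<eta> ^ (6 * m)"
      using \<eta>_bounds elim by (intro divide_right_mono mult_left_mono) auto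
    also have "exp (- (2 * ln (real n))) = 1 / real n ^ 2"
      using n by (simp add: exp_minus exp_double field_simps)
    finally show ?case using n by (simp add: power2_eq_square field_simps)
  qed
  show "(\<lambda>n. 1 / \<eta> ^ (6 * m) * (1 / real n)) \<longlonglongrightarrow> 0"
    by (intro tendsto_mult_right_zero) real_asymp
qed auto

lemma excess_subgraph_bound_le:
  fixes n :: real
  assumes "1 \<le> n" "1 \<le> b" "0 \<le> C" "C * ln (exp 1 * b) + 2 \<le> real m" "real L \<le> C * ln n"
  shows "real L * ((exp 1 * b) ^ L * (b * real L ^ 2) ^ m * (n / n ^ m)) \<le>
    C ^ (2 * m + 1) * b ^ m * (ln n ^ (2 * m + 1) / n)"
proof -
  let ?\<theta> = "C * ln (exp 1 * b)"
  have "(exp 1 * b) ^ L = exp (real L * ln (exp 1 * b))"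
    using \<open>1 \<le> b\<close> by (simp add: exp_of_nat_mult)
  also have "\<dots> \<le> exp (C * ln n * ln (exp 1 * b))"
    using assms(2,5) by (intro iffD2[OF exp_le_cancel_iff] mult_right_mono) (auto simp: ln_mult)
  also have "\<dots> = n powr ?\<theta>"
    using \<open>1 \<le> n\<close> by (simp add: powr_def mult_ac)
  finally have "(exp 1 * b) ^ L * (n / n ^ m) \<le> n powr ?\<theta> * (n / n ^ m)"
    using \<open>1 \<le> n\<close> by (intro mult_right_mono) auto
  also have "\<dots> = n powr (?\<theta> + 1 - real m)"
    using \<open>1 \<le> n\<close> by (simp add: powr_diff powr_add powr_realpow)
  also have "\<dots> \<le> n powr (- 1)"
    using assms(1,4) by (intro powr_mono) auto
  also have "\<dots> = 1 / n"
    using \<open>1 \<le> n\<close> by (simp add: powr_minus_divide)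
  finally have power_le: "(exp 1 * b) ^ L * (n / n ^ m) \<le> 1 / n" .
  have "real L * ((exp 1 * b) ^ L * (b * real L ^ 2) ^ m * (n / n ^ m)) =
      real L ^ (2 * m + 1) * b ^ m * ((exp 1 * b) ^ L * (n / n ^ m))"
    by (simp add: power_mult_distrib mult_ac flip: power_mult)
  also have "\<dots> \<le> (C * ln n) ^ (2 * m + 1) * b ^ m * (1 / n)"
    using assms by (intro mult_mono power_mono power_le) auto
  finally show ?thesis by (simp add: power_mult_distrib mult_ac)
qed

lemma whp_no_excess_subgraph:
  assumes c: "0 < c" "c \<le> b" and b: "1 \<le> b" and C: "0 \<le> C" "C * ln (exp 1 * b) + 2 \<le> real m"
    and L: "\<forall>\<^sub>F n in sequentially. real (L n) \<le> C * ln (real n)"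
  shows "whp (\<lambda>n. gnp n (c / real n)) (\<lambda>n E. \<not> has_excess_subgraph {..<n} (L n) m E)"
proof (rule whp_notI, rule tendsto_sandwich[of "\<lambda>_. 0"])
  show "\<forall>\<^sub>F n in sequentially. prob (gnp n (c / real n)) {E. has_excess_subgraph {..<n} (L n) m E} \<le>
      C ^ (2 * m + 1) * b ^ m * (ln (real n) ^ (2 * m + 1) / real n)"
    using L eventually_gt_at_top[of 0] eventually_ge_at_top[of "nat \<lceil>c\<rceil>"]
  proof eventually_elim
    case (elim n)
    then have n: "1 \<le> real n" "c \<le> real n" by linarith+
    have "prob (gnp n (c / real n)) {E. has_excess_subgraph {..<n} (L n) m E} \<le>
        real (L n) * ((exp 1 * b) ^ L n * (b * real (L n) ^ 2) ^ m * (real n / real n ^ m))"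
      unfolding gnp_eq_random_subset
      using prob_has_excess_subgraph_le[of "{..<n}" "c / real n" b "L n" m] c b n elim(2)
      by (simp add: lessThan_empty_iff)
    also have "\<dots> \<le> C ^ (2 * m + 1) * b ^ m * (ln (real n) ^ (2 * m + 1) / real n)"
      using n(1) b C elim(1) by (rule excess_subgraph_bound_le)
    finally show ?case .
  qed
  have "(\<lambda>n. ln (real n) ^ (2 * m + 1) / real n) \<longlonglongrightarrow> 0"
    by real_asymp
  then show "(\<lambda>n. C ^ (2 * m + 1) * b ^ m * (ln (real n) ^ (2 * m + 1) / real n)) \<longlonglongrightarrow> 0"
    by (rule tendsto_mult_right_zero)
qed auto

lemma survival_bound_eventually_small:
  assumes "2 \<le> k" "0 < c" "c < core_threshold k" "0 < \<epsilon>"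
  obtains t where "\<forall>\<^sub>F n in sequentially. c * survival_bound k n (c / real n) t \<le> \<epsilon>"
proof -
  have "(\<lambda>t. c * survival_limit k c t) \<longlonglongrightarrow> 0"
    using assms(1-3) by (intro tendsto_mult_right_zero survival_limit_tendsto_0)
  then have "\<forall>\<^sub>F t in sequentially. c * survival_limit k c t < \<epsilon>"
    using \<open>0 < \<epsilon>\<close> by (rule order_tendstoD)
  then obtain t where "c * survival_limit k c t < \<epsilon>"
    by (auto simp: eventually_sequentially)
  moreover have "(\<lambda>n. c * survival_bound k n (c / real n) t) \<longlonglongrightarrow> c * survival_limit k c t"
    using \<open>0 < c\<close> by (intro tendsto_intros survival_bound_tendsto) auto
  ultimately have "\<forall>\<^sub>F n in sequentially. c * survival_bound k n (c / real n) t < \<epsilon>"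
    by (intro order_tendstoD)
  then have "\<forall>\<^sub>F n in sequentially. c * survival_bound k n (c / real n) t \<le> \<epsilon>"
    by eventually_elim simp
  then show ?thesis by (rule that)
qed

lemma whp_card_graph_component_less:
  assumes "3 \<le> k" "\<forall>\<^sub>F n in sequentially. 2 \<le> s n"
    and no_tree: "whp (\<lambda>n. gnp n (p n)) (\<lambda>n E. \<not> has_decorated_tree k {..<n} t (s n) m E)"
    and no_excess: "whp (\<lambda>n. gnp n (p n))
      (\<lambda>n E. \<not> has_excess_subgraph {..<n} (s n * (1 + complete_tree_size k (Suc t))) m E)"
  shows "whp (\<lambda>n. gnp n (p n)) (\<lambda>n E. \<forall>C\<in>graph_components {..<n} (peel k E (Suc t)). card C < s n)"
proof (rule whp_mono[OF whp_conj[OF no_tree no_excess]])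
  show "\<forall>\<^sub>F n in sequentially. \<forall>E\<in>set_pmf (gnp n (p n)). \<not> has_decorated_tree k {..<n} t (s n) m E \<and>
      \<not> has_excess_subgraph {..<n} (s n * (1 + complete_tree_size k (Suc t))) m E \<longrightarrow>
      (\<forall>C\<in>graph_components {..<n} (peel k E (Suc t)). card C < s n)"
    using assms(2)
  proof (eventually_elim, intro ballI impI, elim conjE)
    fix n E C
    assume "2 \<le> s n" "E \<in> set_pmf (gnp n (p n))"
      and "\<not> has_decorated_tree k {..<n} t (s n) m E"
        "\<not> has_excess_subgraph {..<n} (s n * (1 + complete_tree_size k (Suc t))) m E"
      and "C \<in> graph_components {..<n} (peel k E (Suc t))"
    moreover from this have "E \<subseteq> all_edges {..<n}"
      unfolding gnp_eq_random_subset by (intro set_pmf_random_subset)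
    ultimately show "card C < s n"
      using \<open>3 \<le> k\<close> by (intro card_graph_component_less[of "{..<n}" E k "s n" t m C]) auto
  qed
qed

lemma whp_card_peeled_component_less:
  assumes "3 \<le> k" "0 < c" "c < core_threshold k" "0 \<le> B"
    and s: "\<forall>\<^sub>F n in sequentially.
      2 \<le> s n \<and> ln (real n) \<le> real (s n) \<and> real (s n) \<le> B * ln (real n)"
  obtains t where "whp (\<lambda>n. gnp n (c / real n))
    (\<lambda>n E. \<forall>C\<in>graph_components {..<n} (peel k E t). card C < s n)"
proof -
  define b where "b = max 1 c"
  define \<eta> where "\<eta> = exp (- 3) / (2 * b)"
  have b: "c \<le> b" "1 \<le> b" and "0 < \<eta> ^ 3" by (auto simp: b_def \<eta>_def)
  obtain t where survival: "\<forall>\<^sub>F n in sequentially. c * survival_bound k n (c / real n) t \<le> \<eta> ^ 3"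
    using survival_bound_eventually_small[OF _ assms(2,3) \<open>0 < \<eta> ^ 3\<close>] \<open>3 \<le> k\<close> by auto
  define K where "K = 1 + complete_tree_size k (Suc t)"
  define m where "m = nat \<lceil>B * real K * ln (exp 1 * b)\<rceil> + 2"
  have no_tree: "whp (\<lambda>n. gnp n (c / real n)) (\<lambda>n E. \<not> has_decorated_tree k {..<n} t (s n) m E)"
    by (rule whp_no_decorated_tree[OF assms(2) b \<eta>_def survival]) (use s in \<open>eventually_elim, simp\<close>)
  have no_excess: "whp (\<lambda>n. gnp n (c / real n)) (\<lambda>n E. \<not> has_excess_subgraph {..<n} (s n * K) m E)"
  proof (rule whp_no_excess_subgraph[OF assms(2) b])
    show "0 \<le> B * real K" using \<open>0 \<le> B\<close> by simp
    show "B * real K * ln (exp 1 * b) + 2 \<le> real m"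
      using real_nat_ceiling_ge[of "B * real K * ln (exp 1 * b)"] by (simp add: m_def)
    show "\<forall>\<^sub>F n in sequentially. real (s n * K) \<le> B * real K * ln (real n)"
      using s
    proof eventually_elim
      case (elim n)
      then have "real (s n) * real K \<le> B * ln (real n) * real K"
        by (intro mult_right_mono) auto
      then show ?case by (simp add: mult_ac)
    qed
  qed
  have "\<forall>\<^sub>F n in sequentially. 2 \<le> s n"
    using s by eventually_elim simp
  then show ?thesis
    by (rule that[OF whp_card_graph_component_less[OF \<open>3 \<le> k\<close> _ no_tree no_excess[unfolded K_def]]])
qed

theorem theorem4:
  fixes k :: nat and c :: real
  assumes "k \<ge> 3" and "0 < c" and "c < core_threshold k"
  shows "\<exists>t :: nat. \<exists>f :: nat \<Rightarrow> real.
    f \<in> o(\<lambda>n. (ln (real n)) ^ 3) \<and>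
    (\<lambda>n. measure_pmf.prob (gnp n (c / real n))
       {E. \<forall>C \<in> graph_components {..<n} (peel k E t). real (card C) \<le> f n}) \<longlonglongrightarrow> 1"
proof -
  define s where "s n = nat \<lceil>ln (real n)\<rceil>" for n :: nat
  have "\<forall>\<^sub>F n in sequentially. 1 < ln (real n)" by real_asymp
  then have "\<forall>\<^sub>F n in sequentially.
      2 \<le> s n \<and> ln (real n) \<le> real (s n) \<and> real (s n) \<le> 2 * ln (real n)"
    by eventually_elim (simp add: s_def; linarith)
  then obtain t where "whp (\<lambda>n. gnp n (c / real n))
      (\<lambda>n E. \<forall>C\<in>graph_components {..<n} (peel k E t). card C < s n)"
    by (rule whp_card_peeled_component_less[OF assms zero_le_numeral])
  then have "whp (\<lambda>n. gnp n (c / real n))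
      (\<lambda>n E. \<forall>C\<in>graph_components {..<n} (peel k E t). real (card C) \<le> ln (real n))"
  proof (rule whp_mono, intro always_eventually allI ballI impI)
    fix n and E :: "nat set set" and C
    assume "\<forall>C\<in>graph_components {..<n} (peel k E t). card C < s n"
      "C \<in> graph_components {..<n} (peel k E t)"
    then have "card C < s n" by blast
    then show "real (card C) \<le> ln (real n)" unfolding s_def by linarith
  qed
  moreover have "(\<lambda>n. ln (real n)) \<in> o(\<lambda>n. ln (real n) ^ 3)"
    by real_asymp
  ultimately show ?thesis unfolding whp_def by blast
qed

end
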